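(* If $R$ is a consistent triple set, then $\min(\mathfrak{sc}(R))=\mathrm{MIN}(\mathfrak{sc}(R))$; that is, every inclusion-minimal representative subset of $R$ has minimum cardinality among all representative subsets of $R$ (and in particular all inclusion-minimal representative subsets of $R$ have the same cardinality).
   Context: Rooted trees: a rooted tree $T$ has a distinguished inner vertex $\rho_T$ (the root); leaves are the vertices of degree 1; every inner vertex other than the root has degree at least 3. A triple $ab|c$ is the rooted binary tree on three leaves $a,b,c$ in which the path from $a$ to $b$ does not meet the path from $c$ to the root; $ab|c=ba|c$. A rooted tree $T$ displays $ab|c$ if $a,b,c$ are leaves of $T$ and the path from $a$ to $b$ does not intersect the path from $c$ to $\rho_T$. $\mathcal R(T)$ is the set of triples displayed by $T$. A triple set $R$ is consistent if some rooted tree displays all of it. $L_R$ is the set of leaves occurring in triples of $R$. $\mathrm{span}(R)$ is the set of rooted trees with leaf set $L_R$ displaying $R$; $\mathrm{cl}(R)=\bigcap_{T\in\mathrm{span}(R)}\mathcal R(T)$. $\mathfrak{sc}(R)=\{R'\subseteq R:\mathrm{cl}(R')=\mathrm{cl}(R)\}$ (representative subsets); $\min(\mathfrak{sc}(R))$ is the set of inclusion-minimal elements of $\mathfrak{sc}(R)$; $\mathrm{MIN}(\mathfrak{sc}(R))=\{R'\in\mathfrak{sc}(R): |R'|\le|R''| \text{ for all } R''\in\mathfrak{sc}(R)\}$. *)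

theory Defs
  imports "Graph_Theory.Graph_Theory" "HOL-Library.Infinite_Typeclass"
begin

text \<open>
  As in Graph_Theory, an undirected finite simple graph (\<^locale>\<open>pair_graph\<close>) is a finite
  symmetric loop-free digraph.  The library predicate \<^const>\<open>tree\<close> only excludes directed
  cycles, and in a symmetric digraph every edge is a directed cycle of length 2, so it does not
  describe undirected trees; hence the explicit acyclicity condition below.
\<close>

definition undirected_tree :: "'v pair_pre_digraph \<Rightarrow> bool" where
  "undirected_tree G \<longleftrightarrow>
     pair_graph G \<and> Digraph_Component.connected (with_proj G) \<and>
     \<not> (\<exists>p. vpath p (with_proj G) \<and> 3 \<le> length p \<and> (last p, hd p) \<in> parcs G)"

text \<open>
  Leaves and inner vertices share the type \<open>'v\<close>, and the leaves themselves occur in triples.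
  The theorem takes \<open>'v\<close> in class \<open>infinite\<close>, as the universe of possible vertices: over a
  finite type there might be no room for the inner vertices of a tree with a given leaf set.
\<close>

record 'v rooted_graph =
  tgraph :: "'v pair_pre_digraph"
  root :: 'v

definition tverts :: "'v rooted_graph \<Rightarrow> 'v set" where
  "tverts T = pverts (tgraph T)"

text \<open>In a symmetric digraph the out-degree is the degree of the undirected graph.\<close>

definition degree :: "'v rooted_graph \<Rightarrow> 'v \<Rightarrow> nat" where
  "degree T v = out_degree (with_proj (tgraph T)) v"

definition leaves :: "'v rooted_graph \<Rightarrow> 'v set" where
  "leaves T = {v \<in> tverts T. degree T v = 1}"

definition inner_verts :: "'v rooted_graph \<Rightarrow> 'v set" where
  "inner_verts T = tverts T - leaves T"

definition rooted_tree :: "'v rooted_graph \<Rightarrow> bool" where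
  "rooted_tree T \<longleftrightarrow>
     undirected_tree (tgraph T) \<and> root T \<in> inner_verts T \<and>
     (\<forall>v \<in> inner_verts T - {root T}. 3 \<le> degree T v)"

definition path_between :: "'v rooted_graph \<Rightarrow> 'v \<Rightarrow> 'v list \<Rightarrow> 'v \<Rightarrow> bool" where
  "path_between T x p y \<longleftrightarrow> vpath p (with_proj (tgraph T)) \<and> hd p = x \<and> last p = y"

text \<open>
  The triple $ab|c$ (for distinct $a,b,c$), as a rooted tree with given leaves, is determined by
  the unordered pair $\{a,b\}$ and by $c$, and is encoded by these data.
\<close>

type_synonym 'v triple = "'v set \<times> 'v"

definition triple :: "'v \<Rightarrow> 'v \<Rightarrow> 'v \<Rightarrow> 'v triple" where
  "triple a b c = ({a, b}, c)"

definition triple_set :: "'v triple set \<Rightarrow> bool" where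
  "triple_set R \<longleftrightarrow> (\<forall>t \<in> R. \<exists>a b c. distinct [a, b, c] \<and> t = triple a b c)"

text \<open>
  The set of triples displayed by a rooted tree. Paths in a tree are unique, so the existential
  quantifiers over \<open>p\<close> and \<open>q\<close> single out \<^emph>\<open>the\<close> path from \<open>a\<close> to \<open>b\<close>
  and \<^emph>\<open>the\<close> path from \<open>c\<close> to the root.
\<close>

definition displayed :: "'v rooted_graph \<Rightarrow> 'v triple set" where
  "displayed T =
     {triple a b c | a b c. distinct [a, b, c] \<and> {a, b, c} \<subseteq> leaves T \<and>
        (\<exists>p q. path_between T a p b \<and> path_between T c q (root T) \<and> set p \<inter> set q = {})}"

definition consistent :: "'v triple set \<Rightarrow> bool" where
  "consistent R \<longleftrightarrow> (\<exists>T. rooted_tree T \<and> R \<subseteq> displayed T)"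

definition leaves_of :: "'v triple set \<Rightarrow> 'v set" where
  "leaves_of R = (\<Union>(P, c) \<in> R. insert c P)"

definition tree_span :: "'v triple set \<Rightarrow> 'v rooted_graph set" where
  "tree_span R = {T. rooted_tree T \<and> leaves T = leaves_of R \<and> R \<subseteq> displayed T}"

definition cl :: "'v triple set \<Rightarrow> 'v triple set" where
  "cl R = (\<Inter>T \<in> tree_span R. displayed T)"

definition representatives :: "'v triple set \<Rightarrow> 'v triple set set" where
  "representatives R = {R'. R' \<subseteq> R \<and> cl R' = cl R}"

definition incl_minimal :: "'b set set \<Rightarrow> 'b set set" where
  "incl_minimal F = {A \<in> F. \<forall>B \<in> F. B \<subseteq> A \<longrightarrow> B = A}"

text \<open>
  Trees are finite, so consistent triple sets and their subsets are finite, and \<^const>\<open>card\<close>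
  is the genuine cardinality where this is used.
\<close>

definition card_minimum :: "'b set set \<Rightarrow> 'b set set" where
  "card_minimum F = {A \<in> F. \<forall>B \<in> F. card A \<le> card B}"

end

(*
  Write ab for the edge contributed by a triple ab|c with a, b, c in L to the Aho graph [R, L].
  By Bryant and Steel, ab|c lies in cl(R) iff some graph [R, L] falls into exactly two connected
  parts, one containing a and b, the other c.  Start from the leaf set of C = cl(R) and repeatedly
  pass from M to the union of at most two components of [C, M].  On the "nice" sets arising this
  way [C, M] has the same components as [R', M] for every R' generating C, because a set L that
  witnesses ab|c and has points on both sides within M is contained in M.  Every triple of C has a
  unique kind (A, B), where the union of A and B is nice with exactly the two components A and B,
  and the triple is ab|c with a, b in A and c in B.  The triples of kind (A, B) in a generating set
  R' have to connect the components of [C, A], and one that is redundant for this is redundant in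
  R'.  So in a minimal R' they form a spanning tree on these components: their number, and hence
  the cardinality of R', depends only on C.
*)
theory Submission
  imports Defs "HOL-Library.Disjoint_Sets"
begin

section \<open>Aho graphs and inference\<close>

text \<open>The obstacle is that \<open>C\<close> and a generating set \<open>R'\<close> have
  different Aho graphs on general vertex sets. With R' = {ab|c, bc|d} the closure contains ab|d, but
  on {a, b, d} the set R' has no edge at all. Niceness excludes such sets. For a kind (A, B), an
  edge inside A comes from a triple with third leaf in A, which already joins two points of one
  component of [R', A], or from one with third leaf in B, which is a triple of this kind. With n
  components in A an irredundant R' thus has exactly n - 1 triples of kind (A, B); kind (B, A) is
  counted separately. Trees enter through the equality of \<open>cl\<close> and
  \<open>infer\<close>. Soundness compares meets of leaves, completeness is a variant of BUILD, with
  hierarchies standing between graphs and trees.\<close>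

definition aho :: "'v triple set \<Rightarrow> 'v set \<Rightarrow> 'v rel" where
  "aho R L = {(a, b). a \<in> L \<and> b \<in> L \<and> (\<exists>c \<in> L. ({a, b}, c) \<in> R)}"

abbreviation conn :: "'v triple set \<Rightarrow> 'v set \<Rightarrow> 'v rel" where
  "conn R L \<equiv> (aho R L)\<^sup>*"

text \<open>If \<open>aho_consistent R\<close>, then \<open>A\<close> and \<open>B\<close> are
  precisely the two components on \<open>A \<union> B\<close>, because a set with two points is
  never connected. Asking only for connections keeps the notion monotone in
  \<open>R\<close>.\<close>

definition splits :: "'v triple set \<Rightarrow> 'v set \<Rightarrow> 'v set \<Rightarrow> bool" where
  "splits R A B \<longleftrightarrow> A \<noteq> {} \<and> B \<noteq> {} \<and> A \<inter> B = {} \<and>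
     A \<times> A \<subseteq> conn R (A \<union> B) \<and> B \<times> B \<subseteq> conn R (A \<union> B)"

text \<open>The criterion of Aho et al.: the graph is disconnected on every set with at least two
  points. As \<open>conn\<close> is reflexive, the empty set and singletons count as
  connected.\<close>

definition aho_consistent :: "'v triple set \<Rightarrow> bool" where
  "aho_consistent R \<longleftrightarrow> (\<forall>L. L \<times> L \<subseteq> conn R L \<longrightarrow> (\<forall>x \<in> L. \<forall>y \<in> L. x = y))"

definition infer :: "'v triple set \<Rightarrow> 'v triple set" where
  "infer R = {({a, b}, c) | a b c. a \<noteq> b \<and> (\<exists>A B. splits R A B \<and> a \<in> A \<and> b \<in> A \<and> c \<in> B)}"

lemma infer_iff:
  "({a, b}, c) \<in> infer R \<longleftrightarrow> a \<noteq> b \<and> (\<exists>A B. splits R A B \<and> a \<in> A \<and> b \<in> A \<and> c \<in> B)"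
  unfolding infer_def by (auto simp: doubleton_eq_iff)

lemma sym_aho: "sym (aho R L)"
  by (auto simp: aho_def sym_def insert_commute)

lemma conn_sym: "(a, b) \<in> conn R L \<Longrightarrow> (b, a) \<in> conn R L"
  using sym_rtrancl[OF sym_aho] by (rule symD)

lemma conn_in: "(a, b) \<in> conn R L \<Longrightarrow> a \<in> L \<Longrightarrow> b \<in> L"
  by (induction rule: rtrancl_induct) (auto simp: aho_def)

lemma conn_class_eq:
  assumes "(x, y) \<in> conn R L" shows "conn R L `` {x} = conn R L `` {y}"
  using rtrancl_trans[OF assms] rtrancl_trans[OF conn_sym[OF assms]] by blast

lemma conn_class_sq: "conn R L `` {x} \<times> conn R L `` {x} \<subseteq> conn R L"
  using conn_class_eq by fast

lemma conn_class_disjoint: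
  assumes "(x, y) \<notin> conn R L" shows "conn R L `` {x} \<inter> conn R L `` {y} = {}"
proof (rule ccontr)
  assume "conn R L `` {x} \<inter> conn R L `` {y} \<noteq> {}"
  then obtain z where "(x, z) \<in> conn R L" "(y, z) \<in> conn R L" by blast
  then show False using assms conn_sym rtrancl_trans by metis
qed

lemma conn_from_point: "(\<And>z. z \<in> M \<Longrightarrow> (x, z) \<in> conn R L) \<Longrightarrow> M \<times> M \<subseteq> conn R L"
  using conn_class_sq[of R L x] by blast

lemma aho_mono: "R \<subseteq> R' \<Longrightarrow> L \<subseteq> L' \<Longrightarrow> aho R L \<subseteq> aho R' L'"
  unfolding aho_def by blast

lemma conn_mono: "R \<subseteq> R' \<Longrightarrow> L \<subseteq> L' \<Longrightarrow> conn R L \<subseteq> conn R' L'"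
  by (intro rtrancl_mono aho_mono)

lemma splits_mono: "splits R A B \<Longrightarrow> R \<subseteq> R' \<Longrightarrow> splits R' A B"
  unfolding splits_def using conn_mono[of R R' "A \<union> B" "A \<union> B"] by blast

lemma infer_mono: assumes "R \<subseteq> R'" shows "infer R \<subseteq> infer R'"
proof
  fix t assume "t \<in> infer R"
  then obtain a b c A B where t: "t = ({a, b}, c)" "a \<noteq> b" "splits R A B" "a \<in> A" "b \<in> A" "c \<in> B"
    unfolding infer_def by blast
  have "splits R' A B" using t(3) assms by (rule splits_mono)
  then show "t \<in> infer R'" using t unfolding infer_def by blast
qed

lemma aho_consistent_mono: "aho_consistent R' \<Longrightarrow> R \<subseteq> R' \<Longrightarrow> aho_consistent R"
  unfolding aho_consistent_def using conn_mono[of R R'] by (meson order_refl order_trans)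

lemma aho_consistentD:
  assumes "aho_consistent R" "L \<times> L \<subseteq> conn R L" "x \<in> L" "y \<in> L" shows "x = y"
  using assms unfolding aho_consistent_def by blast

lemma in_leaves_of: "({a, b}, c) \<in> R \<Longrightarrow> a \<in> leaves_of R \<and> b \<in> leaves_of R \<and> c \<in> leaves_of R"
  unfolding leaves_of_def using UN_upper[of "({a, b}, c)" R "\<lambda>(P, c). insert c P"] by simp

lemma conn_leaves:
  assumes "(x, y) \<in> conn R L" "x \<noteq> y" shows "x \<in> leaves_of R"
  using assms by (cases rule: converse_rtranclE) (auto simp: aho_def dest: in_leaves_of)

text \<open>
  If some \<open>x \<in> B\<close> occurred in no triple, then \<open>B = {x}\<close> and \<open>A\<close> would already be connected
  without it.
\<close>
lemma splits_leaves:
  assumes s: "splits R A B" and c: "aho_consistent R" and ab: "a \<in> A" "b \<in> A" "a \<noteq> b"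
  shows "A \<union> B \<subseteq> leaves_of R"
proof
  fix x assume x: "x \<in> A \<union> B"
  show "x \<in> leaves_of R"
  proof (cases "\<exists>y. (x, y) \<in> conn R (A \<union> B) \<and> x \<noteq> y")
    case True then show ?thesis using conn_leaves by metis
  next
    case False
    then have xB: "x \<in> B" "B = {x}" using x s ab unfolding splits_def by blast+
    show ?thesis
    proof (rule ccontr)
      assume n: "x \<notin> leaves_of R"
      have "aho R (A \<union> B) \<subseteq> aho R A"
        using n xB(2) unfolding aho_def by (auto dest: in_leaves_of)
      then have "conn R (A \<union> B) \<subseteq> conn R A" by (rule rtrancl_mono)
      then have "A \<times> A \<subseteq> conn R A" using s unfolding splits_def by blast
      then show False using aho_consistentD[OF c _ ab(1,2)] ab(3) by blast
    qed
  qed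
qed

lemma triple_setD:
  assumes "triple_set R" "({a, b}, c) \<in> R" shows "a \<noteq> b" "c \<noteq> a" "c \<noteq> b"
proof -
  obtain x y z where "distinct [x, y, z]" "({a, b}, c) = triple x y z"
    using assms unfolding triple_set_def by blast
  then show "a \<noteq> b" "c \<noteq> a" "c \<noteq> b" by (auto simp: triple_def doubleton_eq_iff)
qed

lemma triple_setE:
  assumes "triple_set R" "t \<in> R"
  obtains a b c where "t = ({a, b}, c)" "a \<noteq> b" "c \<noteq> a" "c \<noteq> b"
  using assms unfolding triple_set_def triple_def by fastforce

subsection \<open>Hierarchies\<close>

text \<open>Models the clusters of a rooted tree, that is, the sets of leaves below its vertices.
  For distinct leaves, \<open>separates H a b c\<close> then means that the tree displays
  ab|c.\<close>

definition hierarchy :: "'v set \<Rightarrow> 'v set set \<Rightarrow> bool" where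
  "hierarchy X H \<longleftrightarrow> X \<in> H \<and> {} \<notin> H \<and> (\<forall>K \<in> H. K \<subseteq> X) \<and> (\<forall>x \<in> X. {x} \<in> H) \<and>
     (\<forall>K \<in> H. \<forall>K' \<in> H. K \<subseteq> K' \<or> K' \<subseteq> K \<or> K \<inter> K' = {})"

definition separates :: "'v set set \<Rightarrow> 'v \<Rightarrow> 'v \<Rightarrow> 'v \<Rightarrow> bool" where
  "separates H a b c \<longleftrightarrow> (\<exists>K \<in> H. a \<in> K \<and> b \<in> K \<and> c \<notin> K)"

definition resolves :: "'v set set \<Rightarrow> 'v triple set \<Rightarrow> 'v set \<Rightarrow> bool" where
  "resolves H R L \<longleftrightarrow>
     (\<forall>a \<in> L. \<forall>b \<in> L. \<forall>c \<in> L. ({a, b}, c) \<in> R \<longrightarrow> separates H a b c)"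

lemma hierarchy_glue:
  assumes P: "partition_on L P" and ne: "L \<noteq> {}"
    and h: "\<And>p. p \<in> P \<Longrightarrow> hierarchy p (H p)"
  shows "hierarchy L (insert L (\<Union>p\<in>P. H p))"
proof -
  have sub: "K \<subseteq> p" if "p \<in> P" "K \<in> H p" for K p
    using h[OF that(1)] that(2) unfolding hierarchy_def by blast
  have pL: "p \<subseteq> L" if "p \<in> P" for p using P that unfolding partition_on_def by blast
  have lam: "K \<subseteq> K' \<or> K' \<subseteq> K \<or> K \<inter> K' = {}"
    if "p \<in> P" "K \<in> H p" "p' \<in> P" "K' \<in> H p'" for K K' p p'
  proof (cases "p = p'")
    case True
    then show ?thesis using h[OF that(1)] that unfolding hierarchy_def by blast
  next
    case False
    then have "p \<inter> p' = {}" using P that unfolding partition_on_def disjoint_def by blast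
    then show ?thesis using sub[OF that(1,2)] sub[OF that(3,4)] by blast
  qed
  have subL: "K \<subseteq> L" if "K \<in> insert L (\<Union>p\<in>P. H p)" for K
    using that sub pL by (metis UN_E insertE order_refl order_trans)
  show ?thesis
    unfolding hierarchy_def
  proof (intro conjI ballI)
    show "{} \<notin> insert L (\<Union>p\<in>P. H p)" using h ne unfolding hierarchy_def by blast
    show "K \<subseteq> L" if "K \<in> insert L (\<Union>p\<in>P. H p)" for K using that by (rule subL)
    show "{x} \<in> insert L (\<Union>p\<in>P. H p)" if "x \<in> L" for x
    proof -
      obtain p where "p \<in> P" "x \<in> p" using P \<open>x \<in> L\<close> unfolding partition_on_def by blast
      then show ?thesis using h unfolding hierarchy_def by blast
    qed
    show "K \<subseteq> K' \<or> K' \<subseteq> K \<or> K \<inter> K' = {}"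
      if KK: "K \<in> insert L (\<Union>p\<in>P. H p)" "K' \<in> insert L (\<Union>p\<in>P. H p)" for K K'
    proof (cases "K = L \<or> K' = L")
      case True then show ?thesis using subL KK by blast
    next
      case False
      then obtain p p' where "p \<in> P" "K \<in> H p" "p' \<in> P" "K' \<in> H p'" using KK by blast
      then show ?thesis by (rule lam)
    qed
  qed simp
qed

text \<open>Every Aho edge lies within a block. The block of \<open>a\<close> and \<open>b\<close>
  either contains \<open>c\<close>, and its own hierarchy separates, or it is itself the separating
  cluster.\<close>

lemma resolves_glue:
  assumes h: "\<And>p. p \<in> P \<Longrightarrow> hierarchy p (H p)"
    and r: "\<And>p. p \<in> P \<Longrightarrow> resolves (H p) R p"
    and e: "\<And>a b. (a, b) \<in> aho R L \<Longrightarrow> \<exists>p \<in> P. a \<in> p \<and> b \<in> p"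
  shows "resolves (insert L (\<Union>p\<in>P. H p)) R L"
  unfolding resolves_def
proof (intro ballI impI)
  fix a b c assume "a \<in> L" "b \<in> L" and c: "c \<in> L" "({a, b}, c) \<in> R"
  then have "(a, b) \<in> aho R L" unfolding aho_def by blast
  then obtain p where p: "p \<in> P" "a \<in> p" "b \<in> p" using e by blast
  have "separates (H p) a b c"
  proof (cases "c \<in> p")
    case True then show ?thesis using r[OF p(1)] p c unfolding resolves_def by blast
  next
    case False
    moreover have "p \<in> H p" using h[OF p(1)] unfolding hierarchy_def by blast
    ultimately show ?thesis using p unfolding separates_def by blast
  qed
  then show "separates (insert L (\<Union>p\<in>P. H p)) a b c"
    using p(1) unfolding separates_def by blast
qed

text \<open>The only cluster added to those of the blocks is \<open>L\<close>, and it contains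
  \<open>c\<close>.\<close>

lemma separates_glue:
  assumes h: "\<And>p. p \<in> P \<Longrightarrow> hierarchy p (H p)"
    and s: "separates (insert L (\<Union>p\<in>P. H p)) a b c" and c: "c \<in> L"
  obtains p where "p \<in> P" "a \<in> p" "b \<in> p" "separates (H p) a b c"
proof -
  obtain K where K: "K \<in> insert L (\<Union>p\<in>P. H p)" "a \<in> K" "b \<in> K" "c \<notin> K"
    using s unfolding separates_def by blast
  then obtain p where p: "p \<in> P" "K \<in> H p" using c by blast
  then have "K \<subseteq> p" using h unfolding hierarchy_def by blast
  then show thesis using that p K unfolding separates_def by blast
qed

section \<open>Partitions into Aho components, BUILD and its variant\<close>

lemma partition_on_merge:
  assumes P: "partition_on L P" and AB: "A \<in> P" "B \<in> P"
  shows "partition_on L (insert (A \<union> B) (P - {A, B}))"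
proof (rule partition_onI)
  show "\<Union> (insert (A \<union> B) (P - {A, B})) = L" using partition_onD1[OF P] AB by blast
next
  fix p q assume "p \<in> insert (A \<union> B) (P - {A, B})" "q \<in> insert (A \<union> B) (P - {A, B})" "p \<noteq> q"
  then show "disjnt p q"
    using disjointD[OF partition_onD2[OF P]] AB unfolding disjnt_def
    by (auto simp: Int_Un_distrib Int_Un_distrib2)
next
  show "{} \<notin> insert (A \<union> B) (P - {A, B})"
    using partition_onD3[OF P] AB by auto
qed

lemma partition_conn: "partition_on L ((\<lambda>x. conn R L `` {x}) ` L)"
proof (rule partition_onI)
  show "\<Union> ((\<lambda>x. conn R L `` {x}) ` L) = L" using conn_in by (fastforce)
next
  fix p q assume "p \<in> (\<lambda>x. conn R L `` {x}) ` L" "q \<in> (\<lambda>x. conn R L `` {x}) ` L" "p \<noteq> q"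
  then obtain x y where xy: "p = conn R L `` {x}" "q = conn R L `` {y}" by blast
  have "(x, y) \<notin> conn R L" using \<open>p \<noteq> q\<close> xy conn_class_eq by metis
  then show "disjnt p q" unfolding disjnt_def xy by (rule conn_class_disjoint)
qed auto

lemma aho_block:
  assumes "(a, b) \<in> aho R L"
  shows "\<exists>p \<in> (\<lambda>x. conn R L `` {x}) ` L. a \<in> p \<and> b \<in> p"
proof -
  have "a \<in> L" using assms unfolding aho_def by blast
  then show ?thesis using assms by blast
qed

text \<open>The algorithm BUILD of Aho, Sagiv, Szymanski and Ullman.\<close>
lemma build:
  assumes R: "triple_set R" "aho_consistent R" and "finite L" "L \<noteq> {}"
  shows "\<exists>H. hierarchy L H \<and> resolves H R L"
  using assms(3,4)
proof (induction "card L" arbitrary: L rule: less_induct)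
  case less
  show ?case
  proof (cases "\<exists>x. L = {x}")
    case True
    then obtain x where "L = {x}" by blast
    then have "hierarchy L {{x}}" "resolves {{x}} R L"
      using triple_setD(1)[OF R(1), of x x x] unfolding hierarchy_def resolves_def by auto
    then show ?thesis by blast
  next
    case False
    let ?P = "(\<lambda>x. conn R L `` {x}) ` L"
    have P: "partition_on L ?P" by (rule partition_conn)
    have nt: "\<not> L \<times> L \<subseteq> conn R L"
      using False less.prems aho_consistentD[OF R(2)] by (metis all_not_in_conv is_singletonI' is_singleton_def)
    have lt: "p \<subset> L" if "p \<in> ?P" for p
    proof -
      have "p \<subseteq> L" using P that unfolding partition_on_def by blast
      moreover have "p \<times> p \<subseteq> conn R L" using that conn_class_sq[of R L] by auto
      then have "p \<noteq> L" using nt by auto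
      ultimately show ?thesis by blast
    qed
    have "\<exists>H. hierarchy p H \<and> resolves H R p" if "p \<in> ?P" for p
      using less.hyps[of p] lt[OF that] less.prems that psubset_card_mono[of L p] finite_subset[of p L]
      by blast
    then obtain H where H: "\<And>p. p \<in> ?P \<Longrightarrow> hierarchy p (H p)" "\<And>p. p \<in> ?P \<Longrightarrow> resolves (H p) R p"
      by metis
    have e: "\<exists>p \<in> ?P. a \<in> p \<and> b \<in> p" if "(a, b) \<in> aho R L" for a b
      using that by (rule aho_block)
    show ?thesis using hierarchy_glue[OF P less.prems(2) H(1)] resolves_glue[OF H e] by blast
  qed
qed

text \<open>The core of completeness. If \<open>a\<close> and \<open>b\<close> lie in different
  components, any hierarchy glued from the components avoids the triple. Otherwise the components of
  \<open>a\<close> and \<open>c\<close> are merged into one block \<open>M\<close>, on which the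
  induction hypothesis avoids the triple; apart from \<open>L\<close>, only clusters inside
  \<open>M\<close> contain \<open>a\<close>.\<close>

lemma build_avoiding:
  assumes R: "triple_set R" "aho_consistent R" and t: "a \<noteq> b" "({a, b}, c) \<notin> infer R"
    and "finite L" "a \<in> L" "b \<in> L" "c \<in> L"
  shows "\<exists>H. hierarchy L H \<and> resolves H R L \<and> \<not> separates H a b c"
  using assms(5-8)
proof (induction "card L" arbitrary: L rule: less_induct)
  case less
  let ?k = "\<lambda>x. conn R L `` {x}"
  let ?P = "?k ` L"
  have P: "partition_on L ?P" by (rule partition_conn)
  have subL: "?k x \<subseteq> L" if "x \<in> L" for x using conn_in that by fast
  have ne: "L \<noteq> {}" using less.prems by blast
  have b: "\<exists>H. hierarchy p H \<and> resolves H R p" if "p \<in> ?P" for p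
    using build[OF R, of p] P that less.prems(1) unfolding partition_on_def
    by (metis Union_upper finite_subset)
  then obtain H where H: "\<And>p. p \<in> ?P \<Longrightarrow> hierarchy p (H p)" "\<And>p. p \<in> ?P \<Longrightarrow> resolves (H p) R p"
    by metis
  have e: "\<exists>p \<in> ?P. a \<in> p \<and> b \<in> p" if "(a, b) \<in> aho R L" for a b
    using that by (rule aho_block)
  show ?case
  proof (cases "(a, b) \<in> conn R L")
    case False
    have "\<not> separates (insert L (\<Union>p\<in>?P. H p)) a b c"
    proof
      assume "separates (insert L (\<Union>p\<in>?P. H p)) a b c"
      then obtain p where "p \<in> ?P" "a \<in> p" "b \<in> p"
        using separates_glue[OF H(1) _ less.prems(4)] by metis
      then obtain x where "p = ?k x" by blast
      then have "(a, b) \<in> conn R L" using conn_class_sq[of R L x] \<open>a \<in> p\<close> \<open>b \<in> p\<close> by blast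
      then show False using False by blast
    qed
    then show ?thesis
      using hierarchy_glue[OF P ne H(1)] resolves_glue[OF H e] by blast
  next
    case True
    define M where "M = ?k a \<union> ?k c"
    obtain A C where M: "M = A \<union> C" "A = ?k a" "C = ?k c" unfolding M_def by blast
    have sub: "M \<subseteq> L" unfolding M_def using subL less.prems by blast
    note sq = conn_class_sq[of R L]
    \<comment> \<open>This is where it matters that ab|c is not inferred: if \<open>M\<close> were
      \<open>L\<close>, either \<open>L\<close> would be connected, or the components of
      \<open>a\<close> and \<open>c\<close> would form a split that infers the triple.\<close>
    have "M \<noteq> L"
    proof
      assume sub: "M = L"
      show False
      proof (cases "(a, c) \<in> conn R L")
        case True
        then have "?k c \<subseteq> ?k a" by (auto intro: rtrancl_trans)
        then have "L \<times> L \<subseteq> conn R L" using sub sq[of a] unfolding M_def by blast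
        then show False using aho_consistentD[OF R(2)] less.prems t(1) by blast
      next
        case False
        then have "?k a \<inter> ?k c = {}" by (rule conn_class_disjoint)
        then have "splits R (?k a) (?k c)"
          using sq[of a] sq[of c] sub unfolding splits_def M_def by auto
        then have "({a, b}, c) \<in> infer R" using True t(1) unfolding infer_iff by blast
        then show False using t(2) by blast
      qed
    qed
    have abc: "a \<in> M" "b \<in> M" "c \<in> M" unfolding M_def using True by auto
    have "finite M" using sub less.prems(1) finite_subset by blast
    then obtain H0 where H0: "hierarchy M H0" "resolves H0 R M" "\<not> separates H0 a b c"
      using less.hyps[of M] abc psubset_card_mono[of L M] sub \<open>M \<noteq> L\<close> less.prems(1) by blast
    let ?Q = "insert M (?P - {A, C})"
    have kaP: "?k a \<in> ?P" "?k c \<in> ?P" using less.prems by auto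
    have Q: "partition_on L ?Q"
      unfolding M by (rule partition_on_merge[OF P kaP])
    define H' where "H' = H(M := H0)"
    have H': "hierarchy p (H' p)" "resolves (H' p) R p" if "p \<in> ?Q" for p
      using that H H0 unfolding H'_def by auto
    have e': "\<exists>p \<in> ?Q. a \<in> p \<and> b \<in> p" if ab: "(a, b) \<in> aho R L" for a b
    proof -
      obtain p where "p \<in> ?P" "a \<in> p" "b \<in> p" using e[OF ab] by metis
      then show ?thesis using M by (cases "p \<in> {A, C}") auto
    qed
    have "\<not> separates (insert L (\<Union>p\<in>?Q. H' p)) a b c"
    proof
      assume "separates (insert L (\<Union>p\<in>?Q. H' p)) a b c"
      then obtain p where p: "p \<in> ?Q" "a \<in> p" "separates (H' p) a b c"
        using separates_glue[OF H'(1) _ less.prems(4)] by metis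
      then have "p = M" using disjointD[OF partition_onD2[OF Q] p(1), of M] abc(1) by auto
      then show False using p H0(3) unfolding H'_def by simp
    qed
    then show ?thesis
      using hierarchy_glue[OF Q ne H'(1)] resolves_glue[OF H' e'] by blast
  qed
qed

section \<open>Counting irredundant generating sets\<close>

lemma conn_equiv: "sym S \<Longrightarrow> equiv UNIV (S\<^sup>*)"
  by (simp add: equivI refl_rtrancl sym_rtrancl trans_rtrancl)

text \<open>The classes of \<open>d\<close> and \<open>e\<close> fuse, and every other class stays
  as it is.\<close>

lemma card_quotient_add_edge:
  assumes fin: "finite A" and S: "sym S" and de: "d \<in> A" "e \<in> A" "(d, e) \<notin> S\<^sup>*"
  shows "card (A // (S \<union> {(d, e), (e, d)})\<^sup>*) + 1 = card (A // S\<^sup>*)"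
proof -
  let ?r = "S\<^sup>*" and ?r' = "(S \<union> {(d, e), (e, d)})\<^sup>*"
  let ?D = "?r `` {d}" and ?E = "?r `` {e}"
  have sy: "(x, y) \<in> ?r \<Longrightarrow> (y, x) \<in> ?r" for x y using sym_rtrancl[OF S] by (rule symD)
  have tr: "(x, y) \<in> ?r \<Longrightarrow> (y, z) \<in> ?r \<Longrightarrow> (x, z) \<in> ?r" for x y z by (rule rtrancl_trans)
  have "sym (S \<union> {(d, e), (e, d)})" using S unfolding sym_def by blast
  then have sy': "(x, y) \<in> ?r' \<Longrightarrow> (y, x) \<in> ?r'" for x y using sym_rtrancl symD by metis
  have tr': "(x, y) \<in> ?r' \<Longrightarrow> (y, z) \<in> ?r' \<Longrightarrow> (x, z) \<in> ?r'" for x y z by (rule rtrancl_trans)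
  have sub: "?r \<subseteq> ?r'" by (rule rtrancl_mono) blast
  have de': "(d, e) \<in> ?r'" by blast
  have r': "(x, y) \<in> ?r' \<longleftrightarrow> (x, y) \<in> ?r \<or> x \<in> ?D \<union> ?E \<and> y \<in> ?D \<union> ?E" for x y
  proof
    assume "(x, y) \<in> ?r'"
    then show "(x, y) \<in> ?r \<or> x \<in> ?D \<union> ?E \<and> y \<in> ?D \<union> ?E"
    proof (induction rule: rtrancl_induct)
      case (step y z)
      from step(2) consider "(y, z) \<in> ?r" | "y = d" "z = e" | "y = e" "z = d" by blast
      then show ?case
      proof cases
        case 1 then show ?thesis using step.IH tr by blast
      qed (use step.IH sy in blast)+
    qed blast
  next
    assume "(x, y) \<in> ?r \<or> x \<in> ?D \<union> ?E \<and> y \<in> ?D \<union> ?E"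
    moreover have "(d, z) \<in> ?r'" if "z \<in> ?D \<union> ?E" for z using that sub de' tr' by blast
    moreover have "(x, y) \<in> ?r'" if "(d, x) \<in> ?r'" "(d, y) \<in> ?r'" using tr'[OF sy'] that .
    ultimately show "(x, y) \<in> ?r'" using sub by auto
  qed
  have cls: "?r' `` {x} = (if x \<in> ?D \<union> ?E then ?D \<union> ?E else ?r `` {x})" for x
  proof -
    have "?r' `` {x} = ?r `` {x} \<union> (if x \<in> ?D \<union> ?E then ?D \<union> ?E else {})"
      using r' by auto
    moreover have "?r `` {x} \<subseteq> ?D" if "x \<in> ?D" using that tr[of d x] by blast
    moreover have "?r `` {x} \<subseteq> ?E" if "x \<in> ?E" using that tr[of e x] by blast
    ultimately show ?thesis by auto
  qed
  have cl: "?r `` {x} = ?r `` {y} \<longleftrightarrow> x \<in> ?r `` {y}" for x y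
    using equiv_class_eq_iff[OF conn_equiv[OF S], of x y] sy by blast
  have "A // ?r' = insert (?D \<union> ?E) (A // ?r - {?D, ?E})"
  proof (rule set_eqI)
    fix K
    have "K \<in> A // ?r' \<longleftrightarrow> (\<exists>x\<in>A. K = (if x \<in> ?D \<union> ?E then ?D \<union> ?E else ?r `` {x}))"
      unfolding quotient_def cls by blast
    also have "\<dots> \<longleftrightarrow> K = ?D \<union> ?E \<or> (\<exists>x\<in>A. x \<notin> ?D \<union> ?E \<and> K = ?r `` {x})"
      using de(1) by auto
    also have "\<dots> \<longleftrightarrow> K \<in> insert (?D \<union> ?E) (A // ?r - {?D, ?E})"
      using cl[of _ d] cl[of _ e] unfolding quotient_def by auto
    finally show "K \<in> A // ?r' \<longleftrightarrow> K \<in> insert (?D \<union> ?E) (A // ?r - {?D, ?E})" .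
  qed
  \<comment> \<open>The fused class is not an old one, so two classes are lost and exactly one is
    gained.\<close>
  moreover have "?D \<union> ?E \<notin> A // ?r"
  proof
    assume "?D \<union> ?E \<in> A // ?r"
    then obtain x where "?D \<union> ?E = ?r `` {x}" unfolding quotient_def by blast
    then have "(x, d) \<in> ?r" "(x, e) \<in> ?r" by blast+
    then show False using de(3) tr[OF sy] by metis
  qed
  moreover have f: "finite (A // ?r)" using fin unfolding quotient_def by simp
  moreover have "{?D, ?E} \<subseteq> A // ?r" "?D \<noteq> ?E" using de unfolding quotient_def by blast+
  moreover from this have "2 \<le> card (A // ?r)" using f card_mono[of "A // ?r" "{?D, ?E}"] by simp
  ultimately show ?thesis by (simp add: card_Diff_subset)
qed

text \<open>Triples that differ only in the third leaf give the same edge. In the count below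
  irredundance rules this out, since the edge of \<open>t\<close> must not be generated by
  \<open>F - {t}\<close>.\<close>

definition edges_of :: "'v triple set \<Rightarrow> 'v rel" where
  "edges_of F = {(d, e). {d, e} \<in> fst ` F}"

lemma edges_of_insert: "edges_of (insert ({d, e}, f) F) = edges_of F \<union> {(d, e), (e, d)}"
  unfolding edges_of_def by (auto simp: doubleton_eq_iff)

lemma edges_of_mono: "F \<subseteq> G \<Longrightarrow> edges_of F \<subseteq> edges_of G"
  unfolding edges_of_def by blast

lemma sym_edges_of: "sym (edges_of F)"
  unfolding edges_of_def sym_def by (simp add: insert_commute)

text \<open>On the classes of \<open>S\<close> the edges of \<open>F\<close> form a forest, and each
  edge of a forest lowers the number of classes by one. Irredundance passes to subsets of
  \<open>F\<close>, as fewer edges connect less.\<close>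

lemma card_quotient_irredundant:
  assumes "finite F" "finite A" "sym S"
    and "\<And>t. t \<in> F \<Longrightarrow>
      \<exists>d e f. t = ({d, e}, f) \<and> d \<in> A \<and> e \<in> A \<and> (d, e) \<notin> (S \<union> edges_of (F - {t}))\<^sup>*"
  shows "card (A // (S \<union> edges_of F)\<^sup>*) + card F = card (A // S\<^sup>*)"
  using assms(1,4)
proof (induction F)
  case empty
  then show ?case by (simp add: edges_of_def)
next
  case (insert t F)
  have "card (A // (S \<union> edges_of F)\<^sup>*) + card F = card (A // S\<^sup>*)"
  proof (rule insert.IH)
    fix u assume u: "u \<in> F"
    have "(S \<union> edges_of (F - {u}))\<^sup>* \<subseteq> (S \<union> edges_of (insert t F - {u}))\<^sup>*"
      by (intro rtrancl_mono Un_mono edges_of_mono) auto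
    then show "\<exists>d e f. u = ({d, e}, f) \<and> d \<in> A \<and> e \<in> A \<and> (d, e) \<notin> (S \<union> edges_of (F - {u}))\<^sup>*"
      using insert.prems[of u] u by blast
  qed
  moreover obtain d e f where t: "t = ({d, e}, f)" "d \<in> A" "e \<in> A"
      "(d, e) \<notin> (S \<union> edges_of F)\<^sup>*"
    using insert.prems[of t] insert.hyps(2) by auto
  moreover have "sym (S \<union> edges_of F)" using assms(3) sym_edges_of by (rule sym_Un)
  ultimately show ?case
    using card_quotient_add_edge[OF assms(2), of "S \<union> edges_of F" d e] insert.hyps
    by (simp add: edges_of_insert Un_assoc)
qed

subsection \<open>Nice vertex sets\<close>

text \<open>The case \<open>x = y\<close> yields single components; \<open>nice_of_kind\<close>
  relies on it.\<close>

inductive nice :: "'v triple set \<Rightarrow> 'v set \<Rightarrow> bool" for C where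
  base: "nice C (leaves_of C)"
| step: "nice C M \<Longrightarrow> x \<in> M \<Longrightarrow> y \<in> M \<Longrightarrow> nice C (conn C M `` {x} \<union> conn C M `` {y})"

lemma nice_subset: "nice C M \<Longrightarrow> M \<subseteq> leaves_of C"
  by (induction rule: nice.induct) (auto dest: conn_in)

text \<open>Survives the passage to components: a witness inside \<open>M\<close> keeps its
  connections there, so \<open>A\<close> lies in the component of \<open>a\<close> and
  \<open>B\<close> in that of \<open>b\<close>, and the components that are retained are retained
  entirely.\<close>

lemma nice_absorbs:
  assumes "nice C M" and s: "splits C A B" "A \<union> B \<subseteq> leaves_of C"
    and "a \<in> A" "a \<in> M" "b \<in> B" "b \<in> M"
  shows "A \<union> B \<subseteq> M"
  using assms(1,5,7)
proof (induction rule: nice.induct)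
  case base then show ?case using s by blast
next
  case (step M x y)
  have ab: "a \<in> M" "b \<in> M" using step.prems step.hyps conn_in by fastforce+
  then have "A \<union> B \<subseteq> M" using step.IH by blast
  then have m: "conn C (A \<union> B) \<subseteq> conn C M" by (intro conn_mono) auto
  have "A \<subseteq> conn C M `` {a}" "B \<subseteq> conn C M `` {b}"
    using s m assms(4,6) unfolding splits_def by blast+
  moreover have "conn C M `` {z} \<subseteq> conn C M `` {x} \<union> conn C M `` {y}"
    if "z \<in> conn C M `` {x} \<union> conn C M `` {y}" for z
    using that by (auto intro: rtrancl_trans)
  ultimately show ?case using step.prems by blast
qed

text \<open>An edge ab of [C, M] comes from a triple ab|c with a witness over \<open>R\<close>. As
  \<open>a\<close> and \<open>c\<close> are in \<open>M\<close>, the witness is absorbed by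
  \<open>M\<close> and supplies a path from \<open>a\<close> to \<open>b\<close> in [R, M].\<close>

lemma conn_nice:
  assumes C: "aho_consistent C" and R: "R \<subseteq> C" "C \<subseteq> infer R" and n: "nice C M"
  shows "conn R M = conn C M"
proof
  show "conn R M \<subseteq> conn C M" using R by (intro conn_mono) auto
  have "aho C M \<subseteq> conn R M"
  proof
    fix p assume "p \<in> aho C M"
    then obtain a b c where p: "p = (a, b)" "a \<in> M" "b \<in> M" "c \<in> M" "({a, b}, c) \<in> C"
      unfolding aho_def by blast
    then obtain A B where s: "a \<noteq> b" "splits R A B" "a \<in> A" "b \<in> A" "c \<in> B"
      using R(2) infer_iff by (metis subsetD)
    then have sC: "splits C A B" using splits_mono R(1) by blast
    have "A \<union> B \<subseteq> M"
      using nice_absorbs[OF n sC splits_leaves[OF sC C s(3,4,1)] s(3) p(2) s(5) p(4)] .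
    then have "conn R (A \<union> B) \<subseteq> conn R M" by (intro conn_mono) auto
    then show "p \<in> conn R M" using s p(1) unfolding splits_def by blast
  qed
  then show "conn C M \<subseteq> conn R M" by (metis rtrancl_idemp rtrancl_mono)
qed

section \<open>Kinds of triples and the count for each kind\<close>

definition kinds :: "'v triple set \<Rightarrow> ('v set \<times> 'v set) set" where
  "kinds C = {(A, B). nice C (A \<union> B) \<and> splits C A B}"

definition of_kind :: "'v triple set \<Rightarrow> 'v set \<times> 'v set \<Rightarrow> 'v triple set" where
  "of_kind R \<tau> = {t \<in> R. fst t \<subseteq> fst \<tau> \<and> snd t \<in> snd \<tau>}"

text \<open>A smallest nice set \<open>M\<close> containing \<open>d\<close> and \<open>f\<close>
  works. The components of \<open>d\<close> and \<open>f\<close> in \<open>M\<close> have a nice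
  union, which must be all of \<open>M\<close>; they differ, since otherwise \<open>M\<close> would
  be connected although it contains \<open>d \<noteq> e\<close>.\<close>

lemma ex_kind:
  assumes C: "aho_consistent C" "C \<subseteq> infer C" "finite (leaves_of C)" and t: "({d, e}, f) \<in> C"
  shows "\<exists>A B. (A, B) \<in> kinds C \<and> d \<in> A \<and> e \<in> A \<and> f \<in> B"
proof -
  let ?Q = "\<lambda>M. nice C M \<and> d \<in> M \<and> f \<in> M"
  have "?Q (leaves_of C)" using nice.base in_leaves_of[OF t] by blast
  then obtain M where M: "?Q M" and min: "\<And>M'. ?Q M' \<Longrightarrow> card M \<le> card M'"
    using ex_has_least_nat[of ?Q _ card] by blast
  obtain A B where s: "d \<noteq> e" "splits C A B" "d \<in> A" "e \<in> A" "f \<in> B"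
    using t C(2) infer_iff by (metis subsetD)
  have "A \<union> B \<subseteq> M"
    using nice_absorbs[OF _ s(2) splits_leaves[OF s(2) C(1) s(3,4,1)] s(3) _ s(5)] M by blast
  then have m: "conn C (A \<union> B) \<subseteq> conn C M" by (intro conn_mono) auto
  let ?A = "conn C M `` {d}" and ?B = "conn C M `` {f}"
  have n: "nice C (?A \<union> ?B)" using M nice.step[of C M d f] by simp
  have "?A \<union> ?B \<subseteq> M" using M conn_in[of d _ C M] conn_in[of f _ C M] by auto
  moreover have "finite M" using nice_subset M C(3) finite_subset by metis
  ultimately have eq: "?A \<union> ?B = M" using card_seteq min[of "?A \<union> ?B"] n by blast
  note sq = conn_class_sq[of C M]
  have nc: "(d, f) \<notin> conn C M"
  proof
    assume "(d, f) \<in> conn C M"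
    then have "M = ?A" using eq conn_class_eq[of d f C M] by simp
    then have "M \<times> M \<subseteq> conn C M" using sq[of d] by simp
    moreover have "e \<in> M" using \<open>A \<union> B \<subseteq> M\<close> s by blast
    ultimately show False using aho_consistentD[OF C(1)] M s(1) by blast
  qed
  then have "?A \<inter> ?B = {}" by (rule conn_class_disjoint)
  then have "splits C ?A ?B" unfolding splits_def eq using sq[of d] sq[of f] by blast
  moreover have "e \<in> ?A" using m s unfolding splits_def by blast
  ultimately show ?thesis using n unfolding kinds_def by blast
qed

text \<open>A point of \<open>A\<close> in \<open>B'\<close> would be linked to \<open>d\<close>
  through \<open>A\<close> and to \<open>f\<close> through \<open>B'\<close>, which connects all of
  \<open>A \<union> B\<close>.\<close>

lemma kind_disjoint:
  assumes C: "aho_consistent C" and M: "A \<union> B = A' \<union> B'" "splits C A B" "splits C A' B'"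
    and de: "d \<in> A" "d \<in> A'" "f \<in> B" "f \<in> B'"
  shows "A \<inter> B' = {}"
proof (rule ccontr)
  assume "A \<inter> B' \<noteq> {}"
  then obtain x where x: "x \<in> A" "x \<in> B'" by blast
  have 1: "(d, x) \<in> conn C (A \<union> B)" using M x de unfolding splits_def by blast
  have 2: "(x, f) \<in> conn C (A \<union> B)" using M x de unfolding splits_def by auto
  have "(d, y) \<in> conn C (A \<union> B)" if "y \<in> A \<union> B" for y
  proof (cases "y \<in> A")
    case True then show ?thesis using M de unfolding splits_def by blast
  next
    case False
    then have "(f, y) \<in> conn C (A \<union> B)" using M de that unfolding splits_def by blast
    then show ?thesis using 1 2 by (meson rtrancl_trans)
  qed
  then have "(A \<union> B) \<times> (A \<union> B) \<subseteq> conn C (A \<union> B)" by (rule conn_from_point)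
  then have "d = f" using aho_consistentD[OF C] de by blast
  then show False using M de unfolding splits_def by blast
qed

text \<open>Each of the two nice unions absorbs the other, so they are equal;
  \<open>kind_disjoint\<close> then matches the sides.\<close>

lemma kind_unique:
  assumes C: "aho_consistent C" and k: "(A, B) \<in> kinds C" "(A', B') \<in> kinds C"
    and de: "d \<in> A" "e \<in> A" "f \<in> B" "d \<in> A'" "e \<in> A'" "f \<in> B'"
  shows "(A, B) = (A', B')"
proof -
  have n: "nice C (A \<union> B)" "nice C (A' \<union> B')" "splits C A B" "splits C A' B'"
    using k unfolding kinds_def by auto
  have l: "A \<union> B \<subseteq> leaves_of C" "A' \<union> B' \<subseteq> leaves_of C" using n nice_subset by blast+
  have "A \<union> B \<subseteq> A' \<union> B'" using nice_absorbs[OF n(2,3) l(1) de(1) _ de(3)] de by blast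
  moreover have "A' \<union> B' \<subseteq> A \<union> B" using nice_absorbs[OF n(1,4) l(2) de(4) _ de(6)] de by blast
  ultimately have eq: "A \<union> B = A' \<union> B'" by blast
  have "A \<inter> B' = {}" using kind_disjoint[OF C eq n(3,4)] de by blast
  moreover have "A' \<inter> B = {}" using kind_disjoint[OF C eq[symmetric] n(4,3)] de by blast
  moreover have "A \<inter> B = {}" "A' \<inter> B' = {}" using n unfolding splits_def by simp_all
  ultimately show ?thesis using eq by blast
qed

text \<open>\<open>A\<close> is a component of \<open>A \<union> B\<close>: a path leaving it would
  connect the whole set. Niceness of \<open>A\<close> is what allows \<open>conn_nice\<close> to be
  used on \<open>A\<close> in the count.\<close>

lemma nice_of_kind:
  assumes "(A, B) \<in> kinds C" "aho_consistent C" shows "nice C A"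
proof -
  have n: "nice C (A \<union> B)" "splits C A B" using assms unfolding kinds_def by auto
  obtain a b where ab: "a \<in> A" "b \<in> B" using n(2) unfolding splits_def by blast
  have sub: "A \<subseteq> conn C (A \<union> B) `` {a}" "B \<subseteq> conn C (A \<union> B) `` {b}"
    using n(2) ab unfolding splits_def by blast+
  have "conn C (A \<union> B) `` {a} = A"
  proof (rule ccontr)
    assume "conn C (A \<union> B) `` {a} \<noteq> A"
    then obtain y where y: "(a, y) \<in> conn C (A \<union> B)" "y \<notin> A" using sub by blast
    then have "y \<in> B" using conn_in[OF y(1)] ab by blast
    then have "(y, z) \<in> conn C (A \<union> B)" if "z \<in> B" for z
      using that n(2) unfolding splits_def by blast
    then have "(a, z) \<in> conn C (A \<union> B)" if "z \<in> A \<union> B" for z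
      using that y(1) sub(1) by (meson Image_singleton_iff Un_iff rtrancl_trans subsetD)
    then have "(A \<union> B) \<times> (A \<union> B) \<subseteq> conn C (A \<union> B)" by (rule conn_from_point)
    then have "a = b" using aho_consistentD[OF assms(2)] ab by blast
    then show False using ab n(2) unfolding splits_def by blast
  qed
  then show ?thesis using nice.step[OF n(1), of a a] ab by simp
qed

lemma card_of_kind:
  assumes C: "aho_consistent C" and fin: "finite (leaves_of C)" "finite R" and ts: "triple_set R"
    and R: "R \<subseteq> C" "C \<subseteq> infer R"
    and irr: "\<And>t. t \<in> R \<Longrightarrow> t \<notin> infer (R - {t})"
    and k: "(A, B) \<in> kinds C"
  shows "card (of_kind R (A, B)) + 1 = card (A // conn C A)"
proof -
  let ?F = "of_kind R (A, B)"
  have n: "nice C (A \<union> B)" "splits C A B" using k unfolding kinds_def by auto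
  have s: "splits R A B" using n(2) conn_nice[OF C R n(1)] unfolding splits_def by simp
  have dis: "A \<inter> B = {}" and sA: "A \<times> A \<subseteq> conn R (A \<union> B)" and sB: "B \<times> B \<subseteq> conn R (A \<union> B)"
    using s unfolding splits_def by auto
  have finA: "finite A" using nice_subset[OF n(1)] fin(1) finite_subset by blast
  have no_cross: "y \<in> A" if "(x, y) \<in> aho R (A \<union> B)" "x \<in> A" for x y
  proof (rule ccontr)
    assume "y \<notin> A"
    then have y: "y \<in> B" using that unfolding aho_def by blast
    have xy: "(x, y) \<in> conn R (A \<union> B)" using that by blast
    have "(x, z) \<in> conn R (A \<union> B)" if "z \<in> A \<union> B" for z
      using that sA sB \<open>x \<in> A\<close> y rtrancl_trans[OF xy] by blast
    then have "(A \<union> B) \<times> (A \<union> B) \<subseteq> conn R (A \<union> B)" by (rule conn_from_point)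
    then have "x = y" using aho_consistentD[OF aho_consistent_mono[OF C R(1)]] \<open>x \<in> A\<close> y by blast
    then show False using \<open>x \<in> A\<close> y dis by blast
  qed
  \<comment> \<open>The two alternatives correspond to a third leaf in \<open>A\<close> and in
    \<open>B\<close>.\<close>
  have edge: "(x, y) \<in> aho R A \<union> edges_of ?F" if xy: "(x, y) \<in> aho R (A \<union> B)" "x \<in> A" for x y
  proof -
    have "y \<in> A" using no_cross that by blast
    then show ?thesis using xy unfolding aho_def edges_of_def of_kind_def by force
  qed
  have "(x, y) \<in> (aho R A \<union> edges_of ?F)\<^sup>*" if "x \<in> A" "y \<in> A" for x y
  proof -
    have "(x, y) \<in> conn R (A \<union> B)" using sA that by blast
    then have "y \<in> A \<and> (x, y) \<in> (aho R A \<union> edges_of ?F)\<^sup>*"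
    proof (induction rule: rtrancl_induct)
      case base then show ?case using that by blast
    next
      case (step y z)
      then show ?case using edge no_cross by (meson rtrancl.rtrancl_into_rtrancl)
    qed
    then show ?thesis by blast
  qed
  then have cls: "(aho R A \<union> edges_of ?F)\<^sup>* `` {x} \<inter> A = A" if "x \<in> A" for x using that by blast
  have eA: "edges_of ?F \<subseteq> A \<times> A" unfolding edges_of_def of_kind_def by auto
  have cl_in: "y \<in> A" if "(x, y) \<in> (aho R A \<union> edges_of ?F)\<^sup>*" "x \<in> A" for x y
    using that by (induction rule: rtrancl_induct) (use eA in \<open>auto simp: aho_def\<close>)
  have "(aho R A \<union> edges_of ?F)\<^sup>* `` {x} = A" if "x \<in> A" for x using cls[OF that] cl_in that by blast
  then have "A // (aho R A \<union> edges_of ?F)\<^sup>* = {A}" using s unfolding quotient_def splits_def by auto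
  then have one: "card (A // (aho R A \<union> edges_of ?F)\<^sup>*) = 1" by simp
  have "card (A // (aho R A \<union> edges_of ?F)\<^sup>*) + card ?F = card (A // conn R A)"
  proof (rule card_quotient_irredundant[OF _ finA sym_aho])
    show "finite ?F" using fin(2) unfolding of_kind_def by simp
    fix t assume t: "t \<in> ?F"
    then obtain d e f where tt: "t = ({d, e}, f)" "d \<noteq> e"
      using ts by (auto simp: of_kind_def elim: triple_setE)
    then have def: "d \<in> A" "e \<in> A" "f \<in> B" "t \<in> R" using t unfolding of_kind_def by auto
    have "(d, e) \<notin> (aho R A \<union> edges_of (?F - {t}))\<^sup>*"
    proof
      assume de: "(d, e) \<in> (aho R A \<union> edges_of (?F - {t}))\<^sup>*"
      have "aho R A \<union> edges_of (?F - {t}) \<subseteq> aho (R - {t}) (A \<union> B)"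
      proof (rule Un_least)
        \<comment> \<open>\<open>t\<close> contributes no edge to \<open>aho R A\<close>, because
          its third leaf is in \<open>B\<close>.\<close>
        show "aho R A \<subseteq> aho (R - {t}) (A \<union> B)"
          using tt(1) def dis unfolding aho_def by fastforce
        show "edges_of (?F - {t}) \<subseteq> aho (R - {t}) (A \<union> B)"
          unfolding edges_of_def of_kind_def aho_def by fastforce
      qed
      then have "(d, e) \<in> conn (R - {t}) (A \<union> B)" using de rtrancl_mono by blast
      moreover from this have "(e, d) \<in> conn (R - {t}) (A \<union> B)" by (rule conn_sym)
      \<comment> \<open>Only the edge of \<open>t\<close> can get lost, and its ends are connected
        without it.\<close>
      moreover have "p \<in> aho (R - {t}) (A \<union> B) \<or> p = (d, e) \<or> p = (e, d)"
        if "p \<in> aho R (A \<union> B)" for p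
        using that tt unfolding aho_def by (fastforce simp: doubleton_eq_iff)
      ultimately have "aho R (A \<union> B) \<subseteq> conn (R - {t}) (A \<union> B)" by blast
      then have "conn R (A \<union> B) \<subseteq> conn (R - {t}) (A \<union> B)" by (metis rtrancl_idemp rtrancl_mono)
      then have "splits (R - {t}) A B" using s unfolding splits_def by blast
      then have "t \<in> infer (R - {t})" using infer_iff[of d e f "R - {t}"] tt def by metis
      then show False using irr def by blast
    qed
    then show "\<exists>d e f. t = ({d, e}, f) \<and> d \<in> A \<and> e \<in> A \<and>
        (d, e) \<notin> (aho R A \<union> edges_of (?F - {t}))\<^sup>*" using tt def by blast
  qed
  then show ?thesis using one conn_nice[OF C R nice_of_kind[OF k C]] by simp
qed

text \<open>The right-hand side depends on \<open>C\<close> alone. Its subtraction is never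
  truncated, as \<open>card_of_kind\<close> shows that there is at least one component.\<close>

lemma card_irredundant:
  assumes C: "aho_consistent C" and fin: "finite (leaves_of C)" "finite R" and ts: "triple_set R"
    and R: "R \<subseteq> C" "C \<subseteq> infer R"
    and irr: "\<And>t. t \<in> R \<Longrightarrow> t \<notin> infer (R - {t})"
  shows "card R = (\<Sum>(A, B) \<in> kinds C. card (A // conn C A) - 1)"
proof -
  have CC: "C \<subseteq> infer C"
    using R(2) infer_mono[OF R(1)] by (rule subset_trans)
  have "kinds C \<subseteq> Pow (leaves_of C) \<times> Pow (leaves_of C)"
    unfolding kinds_def by (auto dest!: nice_subset)
  then have fk: "finite (kinds C)" using fin(1) by (meson finite_Pow_iff finite_SigmaI finite_subset)
  have "R = (\<Union>\<tau> \<in> kinds C. of_kind R \<tau>)"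
  proof
    show "R \<subseteq> (\<Union>\<tau> \<in> kinds C. of_kind R \<tau>)"
    proof
      fix t assume t: "t \<in> R"
      then obtain d e f where tt: "t = ({d, e}, f)" using ts by (auto elim: triple_setE)
      then obtain A B where "(A, B) \<in> kinds C" "d \<in> A" "e \<in> A" "f \<in> B"
        using ex_kind[OF C CC fin(1), of d e f] t R(1) by blast
      then show "t \<in> (\<Union>\<tau> \<in> kinds C. of_kind R \<tau>)" using t tt unfolding of_kind_def by force
    qed
  qed (auto simp: of_kind_def)
  moreover have "card (\<Union>\<tau> \<in> kinds C. of_kind R \<tau>) = (\<Sum>\<tau> \<in> kinds C. card (of_kind R \<tau>))"
  proof (rule card_UN_disjoint[OF fk])
    show "\<forall>\<tau>\<in>kinds C. finite (of_kind R \<tau>)" using fin(2) unfolding of_kind_def by simp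
    show "\<forall>\<tau>\<in>kinds C. \<forall>\<sigma>\<in>kinds C. \<tau> \<noteq> \<sigma> \<longrightarrow> of_kind R \<tau> \<inter> of_kind R \<sigma> = {}"
    proof (intro ballI impI, rule ccontr)
      fix \<tau> \<sigma> assume k: "\<tau> \<in> kinds C" "\<sigma> \<in> kinds C" "\<tau> \<noteq> \<sigma>" "of_kind R \<tau> \<inter> of_kind R \<sigma> \<noteq> {}"
      then obtain t where t: "t \<in> R" "t \<in> of_kind R \<tau>" "t \<in> of_kind R \<sigma>" unfolding of_kind_def by blast
      then obtain d e f where tt: "t = ({d, e}, f)" using ts by (auto elim: triple_setE)
      obtain A B A' B' where "\<tau> = (A, B)" "\<sigma> = (A', B')" by fastforce
      then show False
        using kind_unique[OF C, of A B A' B' d e f] k t tt unfolding of_kind_def by auto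
    qed
  qed
  moreover have "(\<Sum>\<tau> \<in> kinds C. card (of_kind R \<tau>)) = (\<Sum>(A, B) \<in> kinds C. card (A // conn C A) - 1)"
  proof (rule sum.cong[OF refl])
    fix \<tau> assume k: "\<tau> \<in> kinds C"
    obtain A B where \<tau>: "\<tau> = (A, B)" by fastforce
    then show "card (of_kind R \<tau>) = (case \<tau> of (A, B) \<Rightarrow> card (A // conn C A) - 1)"
      using card_of_kind[OF C fin ts R irr, of A B] k by simp
  qed
  ultimately show ?thesis by simp
qed

section \<open>Rooted trees\<close>

abbreviation adj :: "'v rooted_graph \<Rightarrow> 'v \<Rightarrow> 'v \<Rightarrow> bool" where
  "adj T x y \<equiv> (x, y) \<in> parcs (tgraph T)"

lemma vwalk_arcs_successively:
  "set (vwalk_arcs p) \<subseteq> E \<longleftrightarrow> successively (\<lambda>x y. (x, y) \<in> E) p"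
  by (induction p rule: vwalk_arcs.induct) auto

lemma path_between_iff:
  "path_between T x p y \<longleftrightarrow> p \<noteq> [] \<and> distinct p \<and> set p \<subseteq> tverts T \<and> successively (adj T) p \<and>
     hd p = x \<and> last p = y"
  unfolding path_between_def vpath_def vwalk_def tverts_def
  by (auto simp: vwalk_arcs_successively)

text \<open>The ancestors of \<open>v\<close>, including \<open>v\<close>; the choice of path is
  immaterial since paths are unique. Meets of vertices become intersections of these sets.\<close>

definition anc :: "'v rooted_graph \<Rightarrow> 'v \<Rightarrow> 'v set" where
  "anc T v = set (SOME p. path_between T v p (root T))"

locale utree =
  fixes T :: "'v rooted_graph"
  assumes tree: "undirected_tree (tgraph T)" and root_in: "root T \<in> tverts T"
begin

lemma adj_sym: "adj T x y \<Longrightarrow> adj T y x"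
proof -
  interpret pair_graph "tgraph T" using tree unfolding undirected_tree_def by blast
  show "adj T x y \<Longrightarrow> adj T y x" by (rule arcs_symmetric)
qed

lemma finite_tverts: "finite (tverts T)"
proof -
  interpret pair_graph "tgraph T" using tree unfolding undirected_tree_def by blast
  show ?thesis unfolding tverts_def by (rule pair_finite_verts)
qed

lemma no_cycle:
  assumes "distinct p" "set p \<subseteq> tverts T" "successively (adj T) p" "3 \<le> length p"
  shows "\<not> adj T (last p) (hd p)"
proof -
  have "vpath p (with_proj (tgraph T))"
    unfolding vpath_def vwalk_def using assms by (auto simp: vwalk_arcs_successively tverts_def)
  then show ?thesis using tree assms(4) unfolding undirected_tree_def by blast
qed

lemma ex_path:
  assumes "x \<in> tverts T" "y \<in> tverts T" shows "\<exists>p. path_between T x p y"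
proof -
  interpret pair_graph "tgraph T" using tree unfolding undirected_tree_def by blast
  have "strongly_connected (with_proj (tgraph T))"
    using symmetric_connected_imp_strongly_connected sym_arcs tree
    unfolding undirected_tree_def by blast
  then have "x \<rightarrow>\<^sup>*\<^bsub>with_proj (tgraph T)\<^esub> y"
    using assms unfolding strongly_connected_def tverts_def by simp
  then obtain p where "vwalk p (with_proj (tgraph T))" "hd p = x" "last p = y"
    using reachable_vwalk_conv by blast
  then have "\<exists>q. vpath q (with_proj (tgraph T)) \<and> hd q = x \<and> last q = y" by (rule vwalk_imp_ex_vpath)
  then show ?thesis unfolding path_between_def by blast
qed

lemma successively_rev_adj: "successively (adj T) (rev p) = successively (adj T) p"
proof -
  have "(\<lambda>x y. adj T y x) = adj T" using adj_sym by blast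
  then show ?thesis by (simp only: successively_rev)
qed

text \<open>Two paths that diverge close a cycle where they first meet again.\<close>
lemma path_unique:
  assumes "path_between T x p y" "path_between T x q y" shows "p = q"
  using assms
proof (induction p arbitrary: x q)
  case Nil then show ?case by (simp add: path_between_iff)
next
  case (Cons x' p')
  from Cons.prems(1) have x': "x' = x" by (simp add: path_between_iff)
  obtain q' where q: "q = x # q'"
    using Cons.prems(2) by (cases q) (auto simp: path_between_iff)
  have P: "x \<notin> set p'" "distinct p'" "set p' \<subseteq> tverts T" "x \<in> tverts T"
      "last (x # p') = y" "successively (adj T) (x # p')"
    using Cons.prems(1) x' by (auto simp: path_between_iff)
  have Q: "x \<notin> set q'" "distinct q'" "set q' \<subseteq> tverts T" "last (x # q') = y"
      "successively (adj T) (x # q')"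
    using Cons.prems(2) q by (auto simp: path_between_iff)
  show ?case
  proof (cases "p' = [] \<or> q' = []")
    case True
    then have "p' = [] \<and> q' = []" using P Q last_in_set by (metis last.simps)
    then show ?thesis using x' q by simp
  next
    case False
    then have ne: "p' \<noteq> []" "q' \<noteq> []" by auto
    have adjP: "adj T x (hd p')" "successively (adj T) p'" "last p' = y"
      using P ne by (auto simp: successively_Cons)
    have adjQ: "adj T x (hd q')" "successively (adj T) q'" "last q' = y"
      using Q ne by (auto simp: successively_Cons)
    show ?thesis
    proof (cases "hd p' = hd q'")
      case True
      have "path_between T (hd p') p' y" using P adjP ne by (simp add: path_between_iff)
      moreover have "path_between T (hd p') q' y" using Q adjQ ne True by (simp add: path_between_iff)
      ultimately show ?thesis using Cons.IH x' q by blast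
    next
      case False
      have "\<exists>z \<in> set p'. z \<in> set q'" using adjP(3) adjQ(3) ne last_in_set by metis
      then obtain p1 z p2 where p': "p' = p1 @ z # p2" "z \<in> set q'" "\<forall>w \<in> set p1. w \<notin> set q'"
        by (rule split_list_first_propE)
      obtain q1 q2 where q': "q' = q1 @ z # q2" using split_list[OF p'(2)] by blast
      let ?c = "x # p1 @ z # rev q1"
      have "successively (adj T) (p1 @ [z])"
        using adjP(2) p'(1) by (auto simp: successively_append_iff successively_Cons)
      moreover have "successively (adj T) (rev (q1 @ [z]))"
        using adjQ(2) q' unfolding successively_rev_adj
        by (auto simp: successively_append_iff successively_Cons)
      then have "successively (adj T) (z # rev q1)" by simp
      ultimately have "successively (adj T) (p1 @ z # rev q1)"
        by (simp add: successively_append_iff)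
      moreover have "hd (p1 @ z # rev q1) = hd p'" using p'(1) by (cases p1) auto
      ultimately have succ: "successively (adj T) ?c"
        using adjP(1) by (simp add: successively_Cons)
      have "distinct ?c" using P(1,2) Q(1,2) p' q' by auto
      moreover have "set ?c \<subseteq> tverts T" using P(3,4) Q(3) p'(1) q' by auto
      \<comment> \<open>\<open>p1\<close> and \<open>q1\<close> are not both empty, as the two paths
        differ right after \<open>x\<close>.\<close>
      moreover have "3 \<le> length ?c" using False p'(1) q' by (cases p1; cases q1) auto
      ultimately have "\<not> adj T (last ?c) (hd ?c)" using succ no_cycle by blast
      moreover have "last ?c = hd q'" using q' by (cases q1) auto
      ultimately show ?thesis using adjQ(1) adj_sym by auto
    qed
  qed
qed

section \<open>Ancestors and meets\<close>

lemma anc_eq: "path_between T v p (root T) \<Longrightarrow> anc T v = set p"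
  unfolding anc_def by (metis path_unique someI)

lemma path_suffix:
  assumes "path_between T v (p @ z # s) y" shows "path_between T z (z # s) y"
  using assms by (auto simp: path_between_iff successively_append_iff)

lemma path_to_root:
  assumes "v \<in> tverts T"
  obtains p where "path_between T v p (root T)" "anc T v = set p"
  using ex_path[OF assms root_in] anc_eq by blast

lemma anc_split:
  assumes "path_between T v (p @ z # s) (root T)" shows "anc T z = set (z # s)"
  using anc_eq[OF path_suffix[OF assms]] .

lemma finite_anc: "v \<in> tverts T \<Longrightarrow> finite (anc T v)"
  by (metis path_to_root List.finite_set)

lemma anc_mono:
  assumes "v \<in> tverts T" "z \<in> anc T v" shows "anc T z \<subseteq> anc T v" "z \<in> anc T z"
proof -
  obtain p where p: "path_between T v p (root T)" "anc T v = set p" using path_to_root[OF assms(1)] .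
  then obtain r s where "p = r @ z # s" using assms(2) split_list by metis
  then show "anc T z \<subseteq> anc T v" "z \<in> anc T z" using anc_split[of v r z s] p by auto
qed

lemma anc_comparable:
  assumes v: "v \<in> tverts T" and z: "z \<in> anc T v" "z' \<in> anc T v"
  shows "anc T z \<subseteq> anc T z' \<or> anc T z' \<subseteq> anc T z"
proof -
  obtain p where p: "path_between T v p (root T)" "anc T v = set p" using path_to_root[OF v] .
  then obtain r s where rs: "p = r @ z # s" using z(1) split_list by metis
  have sub: "set p \<subseteq> tverts T" using p by (simp add: path_between_iff)
  show ?thesis
  proof (cases "z' \<in> set (z # s)")
    case True
    then have "z' \<in> anc T z" using anc_split p(1) rs by metis
    moreover have "z \<in> tverts T" using sub rs by auto
    ultimately show ?thesis using anc_mono by blast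
  next
    case False
    then have "z' \<in> set r" using z(2) p(2) rs by auto
    then obtain r1 r2 where "r = r1 @ z' # r2" using split_list by metis
    then have "anc T z' = set (z' # r2 @ z # s)" using anc_split[of v r1 z' "r2 @ z # s"] p(1) rs by simp
    then have "z \<in> anc T z'" by simp
    moreover have "z' \<in> tverts T" using sub \<open>z' \<in> set r\<close> rs by auto
    ultimately show ?thesis using anc_mono by blast
  qed
qed

text \<open>The meet \<open>z\<close> is the first vertex on the way from \<open>a\<close> to the
  root that is also an ancestor of \<open>b\<close>. The path from \<open>a\<close> to
  \<open>b\<close> climbs to \<open>z\<close> and descends from there.\<close>

lemma path_via_meet:
  assumes a: "a \<in> tverts T" and b: "b \<in> tverts T"
  shows "\<exists>p z. path_between T a p b \<and> z \<in> set p \<and> anc T a \<inter> anc T b = anc T z \<and>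
    (\<forall>w \<in> set p. z \<in> anc T w)"
proof -
  obtain P where P: "path_between T a P (root T)" "anc T a = set P" using path_to_root[OF a] .
  obtain Q where Q: "path_between T b Q (root T)" "anc T b = set Q" using path_to_root[OF b] .
  have "\<exists>z \<in> set P. z \<in> set Q" using P(1) Q(1) last_in_set unfolding path_between_iff by metis
  then obtain p1 z s where p1: "P = p1 @ z # s" "z \<in> set Q" "\<forall>w \<in> set p1. w \<notin> set Q"
    by (rule split_list_first_propE)
  obtain p2 s' where p2: "Q = p2 @ z # s'" using split_list[OF p1(2)] by blast
  have "z # s = z # s'"
    using path_unique[OF path_suffix[OF P(1)[unfolded p1(1)]] path_suffix[OF Q(1)[unfolded p2]]] .
  then have s': "s' = s" by simp
  let ?p = "p1 @ z # rev p2"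
  have "successively (adj T) (p1 @ [z])"
    using P(1) p1(1) by (auto simp: path_between_iff successively_append_iff successively_Cons)
  moreover have "successively (adj T) (rev (p2 @ [z]))"
    using Q(1) p2 unfolding successively_rev_adj
    by (auto simp: path_between_iff successively_append_iff successively_Cons)
  then have "successively (adj T) (z # rev p2)" by simp
  ultimately have "successively (adj T) ?p"
    by (simp add: successively_append_iff)
  moreover have "distinct ?p" using P(1) Q(1) p1 p2 by (auto simp: path_between_iff)
  moreover have "set ?p \<subseteq> tverts T" using P(1) Q(1) p1(1) p2 by (auto simp: path_between_iff)
  moreover have "hd ?p = a" using P(1) p1(1) by (cases p1) (auto simp: path_between_iff)
  moreover have "last ?p = b" using Q(1) p2 by (cases p2) (auto simp: path_between_iff)
  ultimately have path: "path_between T a ?p b" by (simp add: path_between_iff)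
  have az: "anc T z = set (z # s)" using anc_split P(1) p1(1) by metis
  have meet: "anc T a \<inter> anc T b = anc T z" unfolding P(2) Q(2) az using p1 p2 s' by auto
  have below: "z \<in> anc T w" if v: "path_between T v (r @ z # s) (root T)" "w \<in> set r"
    for v r w
  proof -
    obtain r1 r2 where "r = r1 @ w # r2" using split_list v(2) by metis
    then show ?thesis using anc_split[of v r1 w "r2 @ z # s"] v(1) by simp
  qed
  have "z \<in> anc T w" if "w \<in> set ?p" for w
    using that below[OF P(1)[unfolded p1(1)]] below[OF Q(1)[unfolded p2 s']] az by auto
  moreover have "z \<in> set ?p" by simp
  ultimately show ?thesis using path meet by blast
qed

text \<open>All vertices of the path from \<open>a\<close> to \<open>b\<close> lie below the meet
  \<open>z\<close>. The path therefore avoids the ancestors of \<open>c\<close> iff \<open>z\<close>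
  is not one of them.\<close>

lemma displayed_anc:
  "displayed T = {triple a b c | a b c. distinct [a, b, c] \<and> {a, b, c} \<subseteq> leaves T \<and>
     \<not> anc T a \<inter> anc T b \<subseteq> anc T c}"
proof -
  have "(\<exists>p q. path_between T a p b \<and> path_between T c q (root T) \<and> set p \<inter> set q = {}) \<longleftrightarrow>
      \<not> anc T a \<inter> anc T b \<subseteq> anc T c" if "{a, b, c} \<subseteq> leaves T" for a b c
  proof -
    have v: "a \<in> tverts T" "b \<in> tverts T" "c \<in> tverts T" using that unfolding leaves_def by auto
    obtain p z where p: "path_between T a p b" "z \<in> set p" "anc T a \<inter> anc T b = anc T z"
      "\<forall>w \<in> set p. z \<in> anc T w"
      using path_via_meet[OF v(1) v(2)] by blast
    obtain q where q: "path_between T c q (root T)" "anc T c = set q" using path_to_root[OF v(3)] .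
    have pv: "set p \<subseteq> tverts T" using p(1) by (simp add: path_between_iff)
    have zz: "z \<in> anc T z" using p(2,4) by blast
    have "set p \<inter> set q = {} \<longleftrightarrow> z \<notin> anc T c"
      using p(2,4) q(2) anc_mono(1)[OF v(3)] by blast
    also have "\<dots> \<longleftrightarrow> \<not> anc T z \<subseteq> anc T c"
      using zz anc_mono(1)[OF v(3)] by blast
    finally have "set p \<inter> set q = {} \<longleftrightarrow> \<not> anc T a \<inter> anc T b \<subseteq> anc T c" unfolding p(3) .
    then show ?thesis using p(1) q(1) path_unique by metis
  qed
  then show ?thesis unfolding displayed_def by (intro Collect_cong) (metis (no_types, lifting))
qed

text \<open>Both meets are ancestors of \<open>b\<close>, and the ancestors of one vertex form a
  chain.\<close>

lemma meet_comparable: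
  assumes "a \<in> tverts T" "b \<in> tverts T" "c \<in> tverts T"
  shows "anc T a \<inter> anc T b \<subseteq> anc T b \<inter> anc T c \<or> anc T b \<inter> anc T c \<subseteq> anc T a \<inter> anc T b"
proof -
  obtain p z where p: "path_between T a p b" "z \<in> set p" "anc T a \<inter> anc T b = anc T z"
    "\<forall>w \<in> set p. z \<in> anc T w"
      using path_via_meet[OF assms(1) assms(2)] by blast
  obtain q y where q: "path_between T b q c" "y \<in> set q" "anc T b \<inter> anc T c = anc T y"
    "\<forall>w \<in> set q. y \<in> anc T w"
      using path_via_meet[OF assms(2) assms(3)] by blast
  have "b \<in> set p" "b \<in> set q"
    using p(1) q(1) unfolding path_between_iff by (metis last_in_set, metis hd_in_set)
  then have "z \<in> anc T b" "y \<in> anc T b" using p(4) q(4) by auto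
  then show ?thesis using anc_comparable[OF assms(2)] unfolding p(3) q(3) by blast
qed

end

lemma utree_rooted_tree: "rooted_tree T \<Longrightarrow> utree T"
  unfolding rooted_tree_def utree_def inner_verts_def by blast

subsection \<open>Soundness of inference\<close>

lemma displayed_iff:
  assumes "rooted_tree T"
  shows "({a, b}, c) \<in> displayed T \<longleftrightarrow> distinct [a, b, c] \<and> {a, b, c} \<subseteq> leaves T \<and>
     \<not> anc T a \<inter> anc T b \<subseteq> anc T c"
  unfolding utree.displayed_anc[OF utree_rooted_tree[OF assms]] triple_def
  by (auto simp: doubleton_eq_iff Int_commute)

text \<open>
  For leaves \<open>a, b\<close> in \<open>L\<close>, \<open>below T L a b\<close> says that the meet of \<open>a\<close> and \<open>b\<close> lies strictly
  below the meet of \<open>L\<close>.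
\<close>
definition below :: "'v rooted_graph \<Rightarrow> 'v set \<Rightarrow> 'v \<Rightarrow> 'v \<Rightarrow> bool" where
  "below T L a b \<longleftrightarrow> \<not> anc T a \<inter> anc T b \<subseteq> (\<Inter>c\<in>L. anc T c)"

lemma below_sym: "below T L a b \<Longrightarrow> below T L b a"
  unfolding below_def by (simp add: Int_commute)

text \<open>The meets of a, b and of b, c are comparable, and the smaller of the two intersections
  lies in \<open>anc T a \<inter> anc T c\<close>.\<close>

lemma below_trans:
  assumes "rooted_tree T" "a \<in> leaves T" "b \<in> leaves T" "c \<in> leaves T"
    and "below T L a b" "below T L b c"
  shows "below T L a c"
  using utree.meet_comparable[OF utree_rooted_tree[OF assms(1)], of a b c] assms
  unfolding below_def leaves_def by blast

text \<open>The meets of \<open>a\<close> with points of \<open>L\<close> form a chain. The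
  \<open>b\<close> for which the meet has the fewest ancestors attains the meet of all of
  \<open>L\<close>.\<close>

lemma ex_not_below:
  assumes T: "rooted_tree T" and L: "L \<subseteq> leaves T" "a \<in> L"
  shows "\<exists>b \<in> L. \<not> below T L a b"
proof (rule ccontr)
  assume "\<not> ?thesis"
  then have all: "below T L a b" if "b \<in> L" for b using that by blast
  interpret utree T using T by (rule utree_rooted_tree)
  have v: "L \<subseteq> tverts T" using L unfolding leaves_def by blast
  obtain b where b: "b \<in> L" and min: "\<And>c. c \<in> L \<Longrightarrow> card (anc T a \<inter> anc T b) \<le> card (anc T a \<inter> anc T c)"
    using ex_has_least_nat[of "\<lambda>b. b \<in> L" a "\<lambda>b. card (anc T a \<inter> anc T b)"] L(2) by blast
  have "anc T a \<inter> anc T b \<subseteq> anc T c" if "c \<in> L" for c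
  proof -
    have "anc T a \<inter> anc T b \<subseteq> anc T a \<inter> anc T c \<or> anc T a \<inter> anc T c \<subseteq> anc T a \<inter> anc T b"
      using meet_comparable[of b a c] v b L(2) that by (auto simp: Int_commute)
    moreover have "finite (anc T a \<inter> anc T b)" using finite_anc v L(2) by blast
    ultimately have "anc T a \<inter> anc T b \<subseteq> anc T a \<inter> anc T c"
      using card_seteq[of "anc T a \<inter> anc T b" "anc T a \<inter> anc T c"] min[OF that] by auto
    then show ?thesis by blast
  qed
  then show False using all[OF b] unfolding below_def by blast
qed

text \<open>For a triple xy|z with \<open>z\<close> in \<open>L\<close>, the meet of
  \<open>x\<close> and \<open>y\<close> is not above \<open>z\<close>, hence strictly below the meet
  of \<open>L\<close>; transitivity extends this to paths.\<close>

lemma conn_below: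
  assumes T: "rooted_tree T" and R: "R \<subseteq> displayed T" and L: "L \<subseteq> leaves T"
    and c: "(a, b) \<in> conn R L" "a \<noteq> b"
  shows "below T L a b"
proof -
  have aho: "x \<in> L \<and> y \<in> L \<and> below T L x y" if "(x, y) \<in> aho R L" for x y
  proof -
    obtain z where z: "x \<in> L" "y \<in> L" "z \<in> L" "({x, y}, z) \<in> R" using \<open>(x, y) \<in> aho R L\<close> unfolding aho_def by blast
    then have "({x, y}, z) \<in> displayed T" using R by blast
    then show ?thesis using z displayed_iff[OF T, of x y z] unfolding below_def by blast
  qed
  have "a = b \<or> a \<in> L \<and> b \<in> L \<and> below T L a b" using c(1)
  proof (induction rule: rtrancl_induct)
    case (step y z)
    then show ?case using aho[OF step.hyps(2)] below_trans[OF T, of a y z L] L by blast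
  qed simp
  then show ?thesis using c(2) by blast
qed

lemma leaves_of_displayed: 
  assumes "R \<subseteq> displayed T" shows "leaves_of R \<subseteq> leaves T"
proof
  fix x assume "x \<in> leaves_of R"
  then obtain P c where "(P, c) \<in> displayed T" "x \<in> insert c P" using assms unfolding leaves_of_def by auto
  then show "x \<in> leaves T" unfolding displayed_def triple_def by auto
qed

lemma displayed_aho_consistent:
  assumes T: "rooted_tree T" and R: "R \<subseteq> displayed T"
  shows "aho_consistent R"
  unfolding aho_consistent_def
proof (intro allI impI ballI, rule ccontr)
  fix L x y assume L: "L \<times> L \<subseteq> conn R L" and xy: "x \<in> L" "y \<in> L" "x \<noteq> y"
  \<comment> \<open>With two points in \<open>L\<close>, each is connected to another one and so
    occurs in a triple.\<close>
  have "z \<in> leaves T" if "z \<in> L" for z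
  proof -
    have "\<exists>w \<in> L. w \<noteq> z" using xy by metis
    then obtain w where "(z, w) \<in> conn R L" "z \<noteq> w" using L \<open>z \<in> L\<close> by blast
    then show ?thesis using conn_leaves[of z w R L] leaves_of_displayed[OF R] by blast
  qed
  then have Ll: "L \<subseteq> leaves T" by blast
  have b: "below T L u v" if "u \<in> L" "v \<in> L" "u \<noteq> v" for u v
    using conn_below[OF T R Ll, of u v] that L by blast
  \<comment> \<open>Covers the case that the point found by \<open>ex_not_below\<close> is
    \<open>x\<close> itself.\<close>
  have "below T L x x" using below_trans[OF T, of x y x L] b xy Ll by blast
  then show False using ex_not_below[OF T Ll xy(1)] b[OF xy(1)] by metis
qed

text \<open>Within \<open>A\<close> and within \<open>B\<close> all pairs meet strictly below the
  meet of \<open>A \<union> B\<close>. That meet is thus attained only across the split, by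
  \<open>a\<close> and \<open>c\<close> in particular, and \<open>c\<close> is not below the meet of
  \<open>a\<close> and \<open>b\<close>.\<close>

lemma infer_displayed:
  assumes T: "rooted_tree T" and R: "R \<subseteq> displayed T"
  shows "infer R \<subseteq> displayed T"
proof
  fix t assume "t \<in> infer R"
  then obtain a b c A B where t: "t = ({a, b}, c)" "a \<noteq> b" and s: "splits R A B"
      and abc: "a \<in> A" "b \<in> A" "c \<in> B"
    unfolding infer_def by blast
  let ?L = "A \<union> B"
  have Ll: "?L \<subseteq> leaves T"
    using splits_leaves[OF s displayed_aho_consistent[OF T R] abc(1,2) t(2)] leaves_of_displayed[OF R]
    by blast
  have bA: "below T ?L u v" if "u \<in> A" "v \<in> A" "u \<noteq> v" for u v
    using conn_below[OF T R Ll, of u v] that s unfolding splits_def by blast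
  have bB: "below T ?L u v" if "u \<in> B" "v \<in> B" "u \<noteq> v" for u v
    using conn_below[OF T R Ll, of u v] that s unfolding splits_def by blast
  have ab: "below T ?L a b" using bA abc t(2) by blast
  have aa: "below T ?L a a" using below_trans[OF T, of a b a ?L] ab below_sym[OF ab] Ll abc by blast
  \<comment> \<open>\<open>d\<close> attains the meet together with \<open>a\<close>, so it is in
    \<open>B\<close>. If \<open>a\<close> and \<open>c\<close> met strictly lower, so would
    \<open>a\<close> and \<open>d\<close>.\<close>
  obtain d where d: "d \<in> ?L" "\<not> below T ?L a d" using ex_not_below[OF T Ll, of a] abc by blast
  have "d \<in> B" using d bA[OF abc(1)] aa by (metis Un_iff)
  have "\<not> below T ?L a c"
  proof
    assume "below T ?L a c"
    then have "below T ?L a d" 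
      using bB[OF abc(3) \<open>d \<in> B\<close>] below_trans[OF T, of a c d ?L] Ll abc d(1) by (metis UnI1 UnI2 subsetD)
    then show False using d(2) by blast
  qed
  then have "\<not> anc T a \<inter> anc T b \<subseteq> anc T c" using ab unfolding below_def by blast
  moreover have "c \<noteq> a" "c \<noteq> b" using s abc unfolding splits_def by blast+
  ultimately show "t \<in> displayed T"
    unfolding t(1) displayed_iff[OF T] using t(2) Ll abc by auto
qed

section \<open>The tree of a hierarchy\<close>

text \<open>\<open>g\<close> turns clusters into vertices; a singleton must receive its own element,
  because leaves are prescribed elements of the type. Two points in \<open>X\<close> make
  \<open>X\<close> different from all singletons, so the root is no leaf.\<close>

locale labelled_hierarchy =
  fixes X :: "'v set" and H :: "'v set set" and g :: "'v set \<Rightarrow> 'v" and x0 y0 :: 'v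
  assumes finX: "finite X" and hier: "hierarchy X H" and two: "x0 \<in> X" "y0 \<in> X" "x0 \<noteq> y0"
    and inj: "inj_on g H" and g_leaf: "\<And>x. x \<in> X \<Longrightarrow> g {x} = x"
begin

lemma top: "X \<in> H" and nonempty: "{} \<notin> H" and sub: "K \<in> H \<Longrightarrow> K \<subseteq> X"
  and sing: "x \<in> X \<Longrightarrow> {x} \<in> H"
  and lam: "K \<in> H \<Longrightarrow> K' \<in> H \<Longrightarrow> K \<subseteq> K' \<or> K' \<subseteq> K \<or> K \<inter> K' = {}"
  using hier unfolding hierarchy_def by blast+

lemma finH: "finite H"
  using finX sub by (meson Pow_iff finite_Pow_iff finite_subset subsetI)

lemma finK: "K \<in> H \<Longrightarrow> finite K"
  using finX sub finite_subset by blast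

lemma g_eq: "K \<in> H \<Longrightarrow> K' \<in> H \<Longrightarrow> g K = g K' \<longleftrightarrow> K = K'"
  using inj by (auto dest: inj_onD)

definition cov :: "'v set \<Rightarrow> 'v set \<Rightarrow> bool" where
  "cov K K' \<longleftrightarrow> K \<in> H \<and> K' \<in> H \<and> K \<subset> K' \<and> \<not> (\<exists>J \<in> H. K \<subset> J \<and> J \<subset> K')"

definition nb :: "'v set \<Rightarrow> 'v set set" where
  "nb K = {K'. cov K K' \<or> cov K' K}"

text \<open>The Hasse diagram of \<open>H\<close>, with each edge in both directions.\<close>

definition cluster_tree :: "'v rooted_graph" where
  "cluster_tree = \<lparr>tgraph = \<lparr>pverts = g ` H, parcs = {(g K, g K') | K K'. cov K K' \<or> cov K' K}\<rparr>, root = g X\<rparr>"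

lemma cluster_tree_simps: "tverts cluster_tree = g ` H" "root cluster_tree = g X"
    "parcs (tgraph cluster_tree) = {(g K, g K') | K K'. cov K K' \<or> cov K' K}" "pverts (tgraph cluster_tree) = g ` H"
  unfolding cluster_tree_def tverts_def by simp_all

lemma cov_H: "cov K K' \<Longrightarrow> K \<in> H \<and> K' \<in> H \<and> K \<subset> K'"
  unfolding cov_def by blast

lemma adj_iff: "K \<in> H \<Longrightarrow> K' \<in> H \<Longrightarrow> adj cluster_tree (g K) (g K') \<longleftrightarrow> cov K K' \<or> cov K' K"
  unfolding cluster_tree_simps using g_eq cov_H by blast

text \<open>Clusters above \<open>K\<close> share its points and are therefore nested, so a cover is
  a unique parent.\<close>

lemma cov_least: assumes "cov K U" "J \<in> H" "K \<subset> J" shows "U \<subseteq> J"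
proof -
  have "K \<noteq> {}" using assms(1) nonempty cov_H by metis
  then have "U \<inter> J \<noteq> {}" using assms cov_H by blast
  then show ?thesis using lam[of U J] assms unfolding cov_def by blast
qed

lemma cov_unique: "cov K U \<Longrightarrow> cov K U' \<Longrightarrow> U = U'"
  using cov_least cov_H by (metis subset_antisym)

lemma ex_cov: assumes "K \<in> H" "K \<noteq> X" shows "\<exists>U. cov K U"
proof -
  have "K \<subset> X" using assms sub by blast
  then obtain U where U: "U \<in> H" "K \<subset> U" and
      min: "\<And>J. J \<in> H \<and> K \<subset> J \<Longrightarrow> card U \<le> card J"
    using ex_has_least_nat[of "\<lambda>J. J \<in> H \<and> K \<subset> J" X card] top by blast
  then have "\<not> (\<exists>J \<in> H. K \<subset> J \<and> J \<subset> U)"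
    using psubset_card_mono[OF finK[OF U(1)]] by (meson not_less)
  then show ?thesis using U assms unfolding cov_def by blast
qed

lemma ex_child: assumes "K \<in> H" "x \<in> K" "K \<noteq> {x}" shows "\<exists>J. cov J K \<and> x \<in> J"
proof -
  let ?Q = "\<lambda>J. J \<in> H \<and> x \<in> J \<and> J \<subset> K"
  have Qx: "?Q {x}" using assms sing sub by blast
  have "\<forall>J. ?Q J \<longrightarrow> card J < Suc (card K)"
    using psubset_card_mono[OF finK[OF assms(1)]] by (meson less_SucI)
  then obtain J where J: "?Q J" and max: "\<And>J'. ?Q J' \<Longrightarrow> card J' \<le> card J"
    using ex_has_greatest_nat[where P = ?Q and k = "{x}" and f = card and b = "Suc (card K)"] Qx by blast
  have "\<not> (\<exists>J' \<in> H. J \<subset> J' \<and> J' \<subset> K)"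
  proof
    assume "\<exists>J' \<in> H. J \<subset> J' \<and> J' \<subset> K"
    then obtain J' where J': "J' \<in> H" "J \<subset> J'" "J' \<subset> K" by blast
    then have "card J < card J'" by (intro psubset_card_mono finK)
    then show False using max[of J'] J J' by auto
  qed
  then show ?thesis using J assms(1) unfolding cov_def by blast
qed

lemma degree_nb: assumes "K \<in> H" shows "degree cluster_tree (g K) = card (nb K)"
proof -
  have nbH: "nb K \<subseteq> H" unfolding nb_def using cov_H by blast
  have "out_arcs (with_proj (tgraph cluster_tree)) (g K) = (\<lambda>K'. (g K, g K')) ` nb K"
  proof -
    have "e \<in> out_arcs (with_proj (tgraph cluster_tree)) (g K) \<longleftrightarrow> e \<in> (\<lambda>K'. (g K, g K')) ` nb K" for e
    proof
      assume "e \<in> out_arcs (with_proj (tgraph cluster_tree)) (g K)"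
      then have "e \<in> parcs (tgraph cluster_tree)" "fst e = g K" by simp_all
      then obtain J J' where J: "e = (g J, g J')" "cov J J' \<or> cov J' J" "fst e = g K"
        unfolding cluster_tree_simps by blast
      then have "J = K" using g_eq[of J K] assms cov_H by auto
      then show "e \<in> (\<lambda>K'. (g K, g K')) ` nb K" using J unfolding nb_def by blast
    next
      assume "e \<in> (\<lambda>K'. (g K, g K')) ` nb K"
      then show "e \<in> out_arcs (with_proj (tgraph cluster_tree)) (g K)"
        by (auto simp: cluster_tree_simps nb_def)
    qed
    then show ?thesis by blast
  qed
  moreover have "inj_on (\<lambda>K'. (g K, g K')) (nb K)" using nbH g_eq by (auto intro!: inj_onI)
  ultimately show ?thesis unfolding degree_def out_degree_def by (simp add: card_image)
qed

lemma fin_nb: "finite (nb K)"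
  using finH by (rule rev_finite_subset) (auto simp: nb_def dest: cov_H)

lemma card_nb_leaf: assumes "x \<in> X" shows "card (nb {x}) = 1"
proof -
  have "{x} \<noteq> X" using two by blast
  then obtain U where U: "cov {x} U" using ex_cov sing assms by blast
  have "\<not> cov K {x}" for K using cov_H[of K "{x}"] nonempty by (metis psubsetE subset_singletonD)
  then have "nb {x} = {U}" unfolding nb_def using U cov_unique by blast
  then show ?thesis by simp
qed

lemma children: assumes "K \<in> H" "\<And>x. K \<noteq> {x}"
  obtains J J' where "cov J K" "cov J' K" "J \<noteq> J'"
proof -
  have "K \<noteq> {}" using assms(1) nonempty by blast
  then obtain x where x: "x \<in> K" by blast
  obtain J where J: "cov J K" "x \<in> J" using ex_child[OF assms(1) x] assms(2) by blast
  then obtain y where y: "y \<in> K" "y \<notin> J" using cov_H by blast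
  obtain J' where "cov J' K" "y \<in> J'" using ex_child[OF assms(1) y(1)] assms(2) by blast
  then show thesis using that J y by blast
qed

lemma card_nb_inner: assumes "K \<in> H" "\<And>x. K \<noteq> {x}"
  shows "2 \<le> card (nb K)" "K \<noteq> X \<Longrightarrow> 3 \<le> card (nb K)"
proof -
  obtain J J' where J: "cov J K" "cov J' K" "J \<noteq> J'" using children[OF assms] by metis
  have "{J, J'} \<subseteq> nb K" using J unfolding nb_def by blast
  then show "2 \<le> card (nb K)" using card_mono[OF fin_nb, of "{J, J'}" K] J(3) by simp
  assume "K \<noteq> X"
  then obtain U where U: "cov K U" using ex_cov assms(1) by blast
  then have "U \<noteq> J" "U \<noteq> J'" using J cov_H by blast+
  moreover have "{J, J', U} \<subseteq> nb K" using J U unfolding nb_def by blast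
  ultimately show "3 \<le> card (nb K)" using card_mono[OF fin_nb, of "{J, J', U}" K] J(3) by simp
qed

text \<open>A singleton has its parent as only neighbour; every other cluster has at least two
  children.\<close>

lemma leaves_cluster_tree: "leaves cluster_tree = X"
proof -
  have "degree cluster_tree (g K) = 1 \<longleftrightarrow> (\<exists>x \<in> X. K = {x})" if K: "K \<in> H" for K
  proof
    assume d: "degree cluster_tree (g K) = 1"
    show "\<exists>x \<in> X. K = {x}"
    proof (rule ccontr)
      assume n: "\<not> (\<exists>x \<in> X. K = {x})"
      have "K \<noteq> {x}" for x using n sub[OF K] by blast
      then show False using card_nb_inner(1)[OF K] d degree_nb[OF K] by simp
    qed
  qed (use degree_nb card_nb_leaf sing in auto)
  then have "leaves cluster_tree = {g K | K. K \<in> H \<and> (\<exists>x \<in> X. K = {x})}"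
    unfolding leaves_def cluster_tree_simps by auto
  also have "\<dots> = X" using g_leaf sing by force
  finally show ?thesis .
qed

lemma inner_degree:
  assumes "v \<in> inner_verts cluster_tree - {root cluster_tree}" shows "3 \<le> degree cluster_tree v"
proof -
  obtain K where K: "K \<in> H" "v = g K" "g K \<notin> X" "g K \<noteq> g X"
    using assms unfolding inner_verts_def leaves_cluster_tree cluster_tree_simps by blast
  have "K \<noteq> {x}" for x using g_leaf[of x] sub[OF K(1)] K(3) by auto
  then show ?thesis using card_nb_inner(2)[OF K(1)] degree_nb[OF K(1)] K by auto
qed

lemma cluster_tree_pair_graph: "pair_graph (tgraph cluster_tree)"
proof
  show "finite (pverts (tgraph cluster_tree))" using finH by (simp add: cluster_tree_simps)
  show "finite (parcs (tgraph cluster_tree))"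
    by (rule finite_subset[of _ "g ` H \<times> g ` H"]) (use finH cov_H in \<open>auto simp: cluster_tree_simps\<close>)
  show "symmetric (with_proj (tgraph cluster_tree))"
    unfolding symmetric_def sym_def by (auto simp: cluster_tree_simps)
  fix e assume "e \<in> parcs (tgraph cluster_tree)"
  then obtain K J where e: "e = (g K, g J)" "cov K J \<or> cov J K" unfolding cluster_tree_simps by blast
  then have H: "K \<in> H" "J \<in> H" "K \<noteq> J" using cov_H by blast+
  show "fst e \<in> pverts (tgraph cluster_tree)" "snd e \<in> pverts (tgraph cluster_tree)"
    using e H by (simp_all add: cluster_tree_simps)
  show "fst e \<noteq> snd e" using e H g_eq by simp
qed

text \<open>A cluster of least size on a cycle would have two distinct parents.\<close>
lemma cluster_tree_no_cycle:
  assumes p: "distinct p" "set p \<subseteq> g ` H" "successively (adj cluster_tree) p" "3 \<le> length p"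
  shows "\<not> adj cluster_tree (last p) (hd p)"
proof
  assume closing: "adj cluster_tree (last p) (hd p)"
  define h where "h = inv_into H g"
  have hg: "h (g K) = K" if "K \<in> H" for K using inv_into_f_f[OF inj that] unfolding h_def .
  have "p \<noteq> []" using p(4) by auto
  then obtain v where v: "v \<in> set p" "\<And>w. w \<in> set p \<Longrightarrow> card (h v) \<le> card (h w)"
    using ex_has_least_nat[of "\<lambda>v. v \<in> set p" "hd p" "\<lambda>v. card (h v)"] hd_in_set by metis
  obtain K where K: "K \<in> H" "v = g K" using v(1) p(2) by blast
  have up: "\<exists>U. w = g U \<and> cov K U" if w: "w \<in> set p" and a: "adj cluster_tree v w \<or> adj cluster_tree w v" for w
  proof -
    obtain J where J: "J \<in> H" "w = g J" using w p(2) by blast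
    have "\<not> J \<subset> K" using v(2)[OF w] psubset_card_mono[OF finK[OF K(1)], of J] hg J K by auto
    moreover have "cov K J \<or> cov J K" using a adj_iff J K by auto
    ultimately show ?thesis using J cov_H by blast
  qed
  obtain p1 p2 where pp: "p = p1 @ v # p2" using v(1) split_list by metis
  \<comment> \<open>The cycle cut open at \<open>v\<close>: the ends of \<open>?r\<close> are the
    two neighbours of \<open>v\<close>. Both are parents of \<open>K\<close>, hence equal, although
    \<open>?r\<close> is distinct and has at least two entries.\<close>
  let ?r = "p2 @ p1"
  have ne: "?r \<noteq> []" and len: "2 \<le> length ?r" using p(4) pp by auto
  have hd: "adj cluster_tree v (hd ?r)"
    using p(3) closing ne unfolding pp
    by (cases p2; cases p1) (auto simp: successively_append_iff successively_Cons)
  have last: "adj cluster_tree (last ?r) v"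
    using p(3) closing ne unfolding pp
    by (cases p1) (auto simp: successively_append_iff successively_Cons split: if_splits)
  have "hd ?r \<in> set p" "last ?r \<in> set p"
    using hd_in_set[OF ne] last_in_set[OF ne] unfolding pp by auto
  then have "hd ?r = last ?r" using up hd last cov_unique by metis
  moreover obtain a r where ar: "?r = a # r" using ne by (cases ?r) auto
  moreover have "r \<noteq> []" using len unfolding ar by auto
  moreover have "distinct ?r" using p(1) unfolding pp by auto
  ultimately show False using last_in_set[of r] by simp
qed

text \<open>Obtained by following parents. The set of vertices on it shows that the ancestors of a
  leaf are the clusters containing it.\<close>

lemma path_up:
  assumes "K \<in> H"
  shows "\<exists>p. path_between cluster_tree (g K) p (g X) \<and> set p = g ` {J \<in> H. K \<subseteq> J}"
  using assms
proof (induction "card X - card K" arbitrary: K rule: less_induct)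
  case less
  show ?case
  proof (cases "K = X")
    case True
    then have "{J \<in> H. K \<subseteq> J} = {X}" using sub top by blast
    moreover have "path_between cluster_tree (g K) [g X] (g X)"
      using True top by (simp add: path_between_iff cluster_tree_simps)
    ultimately show ?thesis by (intro exI[of _ "[g X]"]) simp
  next
    case False
    then obtain U where U: "cov K U" using ex_cov less.prems by blast
    then have UH: "U \<in> H" "K \<subset> U" using cov_H by blast+
    have "card K < card U" using psubset_card_mono[OF finK] UH by blast
    moreover have "card U \<le> card X" using card_mono[OF finX sub] UH by blast
    ultimately have "card X - card U < card X - card K" by linarith
    then obtain p where p: "path_between cluster_tree (g U) p (g X)" "set p = g ` {J \<in> H. U \<subseteq> J}"
      using less.hyps UH(1) by blast
    have up: "{J \<in> H. K \<subseteq> J} = insert K {J \<in> H. U \<subseteq> J}"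
      using cov_least[OF U] UH less.prems by blast
    have "g K \<notin> set p" using p(2) UH less.prems by (auto simp: g_eq)
    moreover have "adj cluster_tree (g K) (g U)" using adj_iff U less.prems UH by blast
    ultimately have "path_between cluster_tree (g K) (g K # p) (g X)"
      using p(1) less.prems by (auto simp: path_between_iff cluster_tree_simps(1) successively_Cons)
    moreover have "set (g K # p) = g ` {J \<in> H. K \<subseteq> J}" unfolding up using p(2) by simp
    ultimately show ?thesis by blast
  qed
qed

lemma cluster_tree_connected: "Digraph_Component.connected (with_proj (tgraph cluster_tree))"
proof -
  interpret pair_graph "tgraph cluster_tree" by (rule cluster_tree_pair_graph)
  have r: "g K \<rightarrow>\<^sup>*\<^bsub>with_proj (tgraph cluster_tree)\<^esub> g X" if "K \<in> H" for K
    using path_up[OF that] unfolding path_between_def vpath_def reachable_vwalk_conv by blast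
  have "(u, v) \<in> rtrancl_on (g ` H) ((parcs (tgraph cluster_tree))\<^sup>s)" if uv: "u \<in> g ` H" "v \<in> g ` H" for u v
  proof -
    have "u \<rightarrow>\<^sup>*\<^bsub>with_proj (tgraph cluster_tree)\<^esub> g X" using r uv(1) by blast
    also have "g X \<rightarrow>\<^sup>*\<^bsub>with_proj (tgraph cluster_tree)\<^esub> v" using r uv(2) symmetric_reachable[OF sym_arcs] by blast
    finally have "(u, v) \<in> rtrancl_on (g ` H) (parcs (tgraph cluster_tree))"
      unfolding reachable_def by (simp add: cluster_tree_simps(4))
    then show ?thesis
      by (rule rtrancl_on_mono[rotated 2]) (auto simp: symcl_def)
  qed
  then show ?thesis unfolding connected_conv using top by (auto simp: cluster_tree_simps(4))
qed

lemma cluster_tree_rooted_tree: "rooted_tree cluster_tree"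
proof -
  have "undirected_tree (tgraph cluster_tree)"
    unfolding undirected_tree_def
  proof (intro conjI cluster_tree_pair_graph cluster_tree_connected notI)
    assume "\<exists>p. vpath p (with_proj (tgraph cluster_tree)) \<and> 3 \<le> length p \<and> (last p, hd p) \<in> parcs (tgraph cluster_tree)"
    then obtain p where p: "path_between cluster_tree (hd p) p (last p)" "3 \<le> length p" "adj cluster_tree (last p) (hd p)"
      unfolding path_between_def by blast
    then show False using cluster_tree_no_cycle[of p] by (auto simp: path_between_iff cluster_tree_simps(1))
  qed
  moreover have "root cluster_tree \<in> inner_verts cluster_tree"
  proof -
    have "X \<noteq> {x}" for x using two by blast
    then have "2 \<le> degree cluster_tree (g X)" using card_nb_inner(1)[OF top] degree_nb[OF top] by simp
    then show ?thesis using top unfolding inner_verts_def leaves_def cluster_tree_simps by auto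
  qed
  ultimately show ?thesis unfolding rooted_tree_def using inner_degree by blast
qed

lemma displayed_cluster_tree:
  "({a, b}, c) \<in> displayed cluster_tree \<longleftrightarrow> distinct [a, b, c] \<and> {a, b, c} \<subseteq> X \<and> separates H a b c"
proof -
  have anc: "anc cluster_tree x = g ` {K \<in> H. x \<in> K}" if x: "x \<in> X" for x
  proof -
    obtain p where "path_between cluster_tree (g {x}) p (root cluster_tree)" "set p = g ` {K \<in> H. {x} \<subseteq> K}"
      using path_up[OF sing[OF x]] by (auto simp: cluster_tree_simps(2))
    then show ?thesis
      using utree.anc_eq[OF utree_rooted_tree[OF cluster_tree_rooted_tree]] g_leaf[OF x] by simp
  qed
  have "\<not> anc cluster_tree a \<inter> anc cluster_tree b \<subseteq> anc cluster_tree c \<longleftrightarrow> separates H a b c" if "{a, b, c} \<subseteq> X"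
  proof -
    have "g K \<in> anc cluster_tree x \<longleftrightarrow> x \<in> K" if "K \<in> H" "x \<in> X" for K x
      using anc that g_eq by auto
    then have "K \<in> H \<Longrightarrow> g K \<in> anc cluster_tree a \<inter> anc cluster_tree b - anc cluster_tree c \<longleftrightarrow> a \<in> K \<and> b \<in> K \<and> c \<notin> K" for K
      using that by auto
    moreover have "anc cluster_tree a \<subseteq> g ` H" using anc that by auto
    ultimately show ?thesis unfolding separates_def by blast
  qed
  then show ?thesis unfolding displayed_iff[OF cluster_tree_rooted_tree] leaves_cluster_tree by blast
qed

end

text \<open>Infinity of the type provides fresh inner vertices.\<close>
lemma tree_of_hierarchy:
  fixes X :: "('v::infinite) set"
  assumes fin: "finite X" and h: "hierarchy X H" and two: "x \<in> X" "y \<in> X" "x \<noteq> y"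
  shows "\<exists>T. rooted_tree T \<and> leaves T = X \<and>
    (\<forall>a b c. ({a, b}, c) \<in> displayed T \<longleftrightarrow> distinct [a, b, c] \<and> {a, b, c} \<subseteq> X \<and> separates H a b c)"
proof -
  define S where "S = (\<lambda>x. {x}) ` X"
  have "H \<subseteq> Pow X" using h unfolding hierarchy_def by blast
  then have finH: "finite (H - S)" using fin by (meson finite_Diff finite_Pow_iff finite_subset)
  have "infinite (- X)" using fin infinite_UNIV by (metis Compl_eq_Diff_UNIV Diff_infinite_finite)
  then obtain F where F: "F \<subseteq> - X" "finite F" "card F = card (H - S)"
    using infinite_arbitrarily_large by metis
  obtain f where f: "bij_betw f (H - S) F" using finite_same_card_bij finH F(2,3) by metis
  define g where "g K = (if K \<in> S then the_elem K else f K)" for K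
  have gS: "g {x} = x" if "x \<in> X" for x using that unfolding g_def S_def by simp
  have gF: "g K \<in> - X" if "K \<in> H - S" for K
    using that f F(1) unfolding g_def bij_betw_def by auto
  have "inj_on g H"
  proof (rule inj_onI)
    fix K J assume KJ: "K \<in> H" "J \<in> H" "g K = g J"
    have S: "g L \<in> X \<and> L = {g L}" if "L \<in> S" for L using that gS unfolding S_def by auto
    show "K = J"
    proof (cases "K \<in> S \<or> J \<in> S")
      case True
      then have "K \<in> S \<and> J \<in> S" using S gF KJ by (metis ComplD DiffI)
      then show ?thesis using S KJ(3) by metis
    next
      case False
      then show ?thesis using f KJ unfolding g_def bij_betw_def inj_on_def by auto
    qed
  qed
  then interpret labelled_hierarchy X H g x y using fin h two gS by unfold_locales auto
  show ?thesis using cluster_tree_rooted_tree leaves_cluster_tree displayed_cluster_tree by blast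
qed

section \<open>The closure and minimal representatives\<close>

lemma tree_span_of_hierarchy:
  fixes R :: "('v::infinite) triple set"
  assumes ts: "triple_set R" and ne: "R \<noteq> {}" and fin: "finite (leaves_of R)"
    and H: "hierarchy (leaves_of R) H" "resolves H R (leaves_of R)"
  obtains T where "T \<in> tree_span R" "\<And>a b c. ({a, b}, c) \<in> displayed T \<Longrightarrow> separates H a b c"
proof -
  obtain x y z where xyz: "({x, y}, z) \<in> R" "x \<noteq> y" using ne ts triple_setE by (metis ex_in_conv)
  then have "x \<in> leaves_of R" "y \<in> leaves_of R" using in_leaves_of[of x y z R] by simp_all
  then obtain T where T: "rooted_tree T" "leaves T = leaves_of R" and
    d: "\<And>a b c. ({a, b}, c) \<in> displayed T \<longleftrightarrow>
      distinct [a, b, c] \<and> {a, b, c} \<subseteq> leaves_of R \<and> separates H a b c"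
    using tree_of_hierarchy[OF fin H(1)] xyz(2) by meson
  have "R \<subseteq> displayed T"
  proof
    fix t assume t: "t \<in> R"
    then obtain a b c where abc: "t = ({a, b}, c)" "a \<noteq> b" "c \<noteq> a" "c \<noteq> b" using ts triple_setE by metis
    then have "a \<in> leaves_of R" "b \<in> leaves_of R" "c \<in> leaves_of R"
      using t in_leaves_of[of a b c R] by simp_all
    then show "t \<in> displayed T" using abc t H(2) unfolding abc(1) d resolves_def by auto
  qed
  then have "T \<in> tree_span R" using T unfolding tree_span_def by blast
  then show thesis using that d by blast
qed

lemma finite_leaves: "rooted_tree T \<Longrightarrow> finite (leaves T)"
  using utree.finite_tverts[OF utree_rooted_tree] unfolding leaves_def by (metis finite_Collect_conjI Collect_mem_eq)

text \<open>The Bryant-Steel theorem: soundness gives one inclusion, and for the other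
  \<open>build_avoiding\<close> yields a tree in the span that does not display a given uninferred
  triple.\<close>

lemma cl_eq_infer:
  fixes R :: "('v::infinite) triple set"
  assumes ts: "triple_set R" and con: "consistent R" and ne: "R \<noteq> {}"
  shows "cl R = infer R"
proof
  obtain T where T: "rooted_tree T" "R \<subseteq> displayed T" using con unfolding consistent_def by blast
  have ac: "aho_consistent R" using displayed_aho_consistent T by blast
  have fin: "finite (leaves_of R)"
    using leaves_of_displayed[OF T(2)] finite_leaves[OF T(1)] finite_subset by blast
  show "infer R \<subseteq> cl R" unfolding cl_def tree_span_def using infer_displayed by blast
  have "leaves_of R \<noteq> {}" using ne unfolding leaves_of_def by auto
  then obtain H where "hierarchy (leaves_of R) H" "resolves H R (leaves_of R)"
    using build[OF ts ac fin] by blast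
  \<comment> \<open>A member of the span is needed, since an empty intersection would be everything.
    It also confines the triples of \<open>cl R\<close> to the leaves of \<open>R\<close>.\<close>
  then obtain S where S: "S \<in> tree_span R" using tree_span_of_hierarchy[OF ts ne fin] by metis
  show "cl R \<subseteq> infer R"
  proof
    fix t assume t: "t \<in> cl R"
    then have "t \<in> displayed S" "leaves S = leaves_of R" using S unfolding cl_def tree_span_def by auto
    then obtain a b c where abc: "t = ({a, b}, c)" "a \<noteq> b"
        "a \<in> leaves_of R" "b \<in> leaves_of R" "c \<in> leaves_of R"
      unfolding displayed_def triple_def by auto
    show "t \<in> infer R"
    proof (rule ccontr)
      assume "t \<notin> infer R"
      then obtain H where H: "hierarchy (leaves_of R) H" "resolves H R (leaves_of R)"
          "\<not> separates H a b c"
        using build_avoiding[OF ts ac abc(2) _ fin abc(3-5)] abc(1) by blast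
      then obtain U where U: "U \<in> tree_span R" "({a, b}, c) \<notin> displayed U"
        using tree_span_of_hierarchy[OF ts ne fin H(1,2)] by metis
      then show False using t unfolding cl_def abc(1) by blast
    qed
  qed
qed

lemma subset_cl: "R \<subseteq> cl R"
  unfolding cl_def tree_span_def by blast

text \<open>Guarantees that representatives of a nonempty set are nonempty, as
  \<open>cl_eq_infer\<close> demands. The case distinction leaves open whether
  \<open>tree_span {}\<close> is inhabited: if it is empty, \<open>cl {}\<close> is
  \<open>UNIV\<close>, which contains pairs that are not triples.\<close>

lemma cl_empty_neq:
  fixes R :: "'v triple set"
  assumes "R \<noteq> {}" "cl R \<subseteq> infer R"
  shows "cl {} \<noteq> cl R"
proof (cases "tree_span {} = ({} :: 'v rooted_graph set)")
  case True
  then have "cl ({} :: 'v triple set) = UNIV" unfolding cl_def by simp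
  moreover have "({}, undefined) \<notin> infer R" unfolding infer_def by auto
  ultimately show ?thesis using assms(2) by (metis UNIV_I subsetD)
next
  case False
  then obtain S where S: "S \<in> tree_span ({} :: 'v triple set)" by blast
  then have "displayed S = {}" unfolding tree_span_def leaves_of_def displayed_def by auto
  then have "cl ({} :: 'v triple set) = {}" using S unfolding cl_def by auto
  then show ?thesis using assms(1) subset_cl[of R] by auto
qed

lemma triple_set_mono: "triple_set R \<Longrightarrow> S \<subseteq> R \<Longrightarrow> triple_set S"
  unfolding triple_set_def by blast

lemma consistent_mono: "consistent R \<Longrightarrow> S \<subseteq> R \<Longrightarrow> consistent S"
  unfolding consistent_def by blast

text \<open>Trees in a span have a prescribed leaf set, so the two spans can be compared because the
  leaf sets agree; every tree in the span of \<open>R - {t}\<close> then displays \<open>t\<close>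
  too.\<close>

lemma cl_remove:
  assumes t: "t \<in> R" "t \<in> cl (R - {t})" and l: "leaves_of (R - {t}) = leaves_of R"
  shows "cl (R - {t}) = cl R"
proof -
  have "R \<subseteq> displayed T" if "T \<in> tree_span (R - {t})" for T
    using that t subset_cl[of "R - {t}"] unfolding cl_def tree_span_def by auto
  then have "tree_span (R - {t}) = tree_span R" unfolding tree_span_def l by auto
  then show ?thesis unfolding cl_def by simp
qed

lemma infer_leaves:
  assumes "aho_consistent R" "t \<in> infer R" shows "insert (snd t) (fst t) \<subseteq> leaves_of R"
proof -
  obtain a b c A B where "t = ({a, b}, c)" "a \<noteq> b" "splits R A B" "a \<in> A" "b \<in> A" "c \<in> B"
    using assms(2) unfolding infer_def by blast
  then show ?thesis using splits_leaves[of R A B a b] assms(1) by auto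
qed

text \<open>If \<open>t\<close> followed from the rest, its leaves would occur there by
  \<open>infer_leaves\<close>, and \<open>cl_remove\<close> would give a smaller
  representative.\<close>

lemma minimal_representative_irredundant:
  fixes R :: "('v::infinite) triple set"
  assumes ts: "triple_set R" and con: "consistent R"
    and A: "A \<in> incl_minimal (representatives R)" and t: "t \<in> A"
  shows "t \<notin> infer (A - {t})"
proof
  assume i: "t \<in> infer (A - {t})"
  have AR: "A \<subseteq> R" "cl A = cl R"
    using A unfolding incl_minimal_def representatives_def by auto
  have "\<exists>p. p \<in> A - {t}"
  proof (rule ccontr)
    assume "\<nexists>p. p \<in> A - {t}"
    then have e: "A - {t} = {}" by blast
    obtain a b c P Q where "a \<noteq> b" "splits (A - {t}) P Q" "a \<in> P" "b \<in> P" "c \<in> Q"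
      using i unfolding infer_def by blast
    then have "(a, b) \<in> conn {} (P \<union> Q)" unfolding splits_def e by blast
    then show False using \<open>a \<noteq> b\<close> by (simp add: aho_def)
  qed
  then have ne: "A - {t} \<noteq> {}" by blast
  have sub: "A - {t} \<subseteq> R" using AR by blast
  have ts': "triple_set (A - {t})" and con': "consistent (A - {t})"
    using triple_set_mono[OF ts sub] consistent_mono[OF con sub] .
  have ac: "aho_consistent (A - {t})"
    using con' displayed_aho_consistent unfolding consistent_def by blast
  have "leaves_of A = leaves_of (A - {t}) \<union> insert (snd t) (fst t)"
    using t unfolding leaves_of_def by (auto split: prod.splits; force)
  then have "leaves_of (A - {t}) = leaves_of A" using infer_leaves[OF ac i] by blast
  moreover have "t \<in> cl (A - {t})" using i cl_eq_infer[OF ts' con' ne] by simp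
  ultimately have "cl (A - {t}) = cl A" using cl_remove t by metis
  then have "A - {t} \<in> representatives R" using AR sub unfolding representatives_def by auto
  then have "A - {t} = A" using A unfolding incl_minimal_def by blast
  then show False using t by blast
qed

lemma card_minimal_representatives:
  fixes R :: "('v::infinite) triple set"
  assumes ts: "triple_set R" and con: "consistent R" and ne: "R \<noteq> {}"
    and A: "A \<in> incl_minimal (representatives R)"
  shows "card A = (\<Sum>(P, Q) \<in> kinds (cl R). card (P // conn (cl R) P) - 1)"
proof -
  have AR: "A \<subseteq> R" "cl A = cl R"
    using A unfolding incl_minimal_def representatives_def by auto
  obtain T where T: "rooted_tree T" "R \<subseteq> displayed T" using con unfolding consistent_def by blast
  have clR: "cl R = infer R" by (rule cl_eq_infer[OF ts con ne])
  then have "A \<noteq> {}" using cl_empty_neq[OF ne] AR(2) by auto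
  then have clA: "cl A = infer A"
    using cl_eq_infer triple_set_mono[OF ts AR(1)] consistent_mono[OF con AR(1)] by blast
  \<comment> \<open>\<open>T\<close> may have more leaves than \<open>R\<close> and need not be in
    the span; soundness of \<open>infer\<close> holds for every tree displaying
    \<open>R\<close>.\<close>
  have d: "cl R \<subseteq> displayed T" unfolding clR by (rule infer_displayed[OF T])
  have finT: "finite (leaves T)" by (rule finite_leaves[OF T(1)])
  have "finite (cl R)"
  proof (rule finite_subset)
    show "cl R \<subseteq> Pow (leaves T) \<times> leaves T" using d unfolding displayed_def triple_def by auto
  qed (use finT in simp)
  show ?thesis
  proof (rule card_irredundant)
    show "aho_consistent (cl R)" by (rule displayed_aho_consistent[OF T(1) d])
    show "finite (leaves_of (cl R))" using leaves_of_displayed[OF d] finT finite_subset by blast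
    show "A \<subseteq> cl R" using AR(1) subset_cl by blast
    then show "finite A" using \<open>finite (cl R)\<close> finite_subset by blast
    show "triple_set A" by (rule triple_set_mono[OF ts AR(1)])
    show "cl R \<subseteq> infer A" using AR(2) clA by simp
    show "t \<notin> infer (A - {t})" if "t \<in> A" for t
      by (rule minimal_representative_irredundant[OF ts con A that])
  qed
qed

section \<open>Finiteness and the comparison of the two notions of minimality\<close>

lemma finite_consistent:
  assumes "consistent R" shows "finite R"
proof -
  obtain T where T: "rooted_tree T" "R \<subseteq> displayed T" using assms unfolding consistent_def by blast
  have "R \<subseteq> Pow (leaves T) \<times> leaves T" using T(2) unfolding displayed_def triple_def by auto
  then show ?thesis using finite_leaves[OF T(1)] by (meson finite_Pow_iff finite_SigmaI finite_subset)
qed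

lemma incl_minimal_eq_card_minimum:
  assumes fin: "\<And>A. A \<in> F \<Longrightarrow> finite A"
    and eq: "\<And>A B. A \<in> incl_minimal F \<Longrightarrow> B \<in> incl_minimal F \<Longrightarrow> card A = card B"
  shows "incl_minimal F = card_minimum F"
proof
  show "card_minimum F \<subseteq> incl_minimal F"
    unfolding card_minimum_def incl_minimal_def using card_seteq fin by blast
  show "incl_minimal F \<subseteq> card_minimum F"
  proof
    fix A assume A: "A \<in> incl_minimal F"
    have "card A \<le> card B" if B: "B \<in> F" for B
    proof -
      \<comment> \<open>A smallest member of \<open>F\<close> inside \<open>B\<close> is
        inclusion-minimal, hence as large as \<open>A\<close>.\<close>
      obtain C where C: "C \<in> F" "C \<subseteq> B" and min: "\<And>D. D \<in> F \<and> D \<subseteq> B \<Longrightarrow> card C \<le> card D"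
        using ex_has_least_nat[of "\<lambda>C. C \<in> F \<and> C \<subseteq> B" B card] B by blast
      have "C \<in> incl_minimal F"
        unfolding incl_minimal_def using C min card_seteq[OF fin[OF C(1)]] by blast
      then show ?thesis using eq[OF A] card_mono[OF fin[OF B] C(2)] by simp
    qed
    then show "A \<in> card_minimum F" using A unfolding card_minimum_def incl_minimal_def by blast
  qed
qed

theorem mainTheorem2:
  fixes R :: "('v::infinite) triple set"
  assumes "triple_set R" and "consistent R"
  shows "incl_minimal (representatives R) = card_minimum (representatives R) \<and>
    (\<forall>A \<in> incl_minimal (representatives R). \<forall>B \<in> incl_minimal (representatives R). card A = card B)"
proof -
  have eq: "card A = card B"
    if "A \<in> incl_minimal (representatives R)" "B \<in> incl_minimal (representatives R)" for A B
  proof (cases "R = {}")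
    case True
    then show ?thesis using that unfolding incl_minimal_def representatives_def by auto
  next
    case False
    show ?thesis
      unfolding that[THEN card_minimal_representatives[OF assms False]] ..
  qed
  moreover have "finite A" if "A \<in> representatives R" for A
    using that finite_subset[OF _ finite_consistent[OF assms(2)]] unfolding representatives_def by blast
  ultimately show ?thesis using incl_minimal_eq_card_minimum[of "representatives R"] by blast
qed

end
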